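(* Let $k$ be a field, $p\in k[t]$ monic irreducible, and $m\ge1$. A complete set of representatives (one for each orbit) for the $G_{(m+1,1)}(p)$-orbits in $E_{(m+1,1)}(p)$ is given by: (1) $\begin{pmatrix} x & 0 \\ 0 & w \end{pmatrix}$, with $x\in k[t]/p^{m+1}$ such that $p\mid x$, and $w\in k[t]/p$. Each of these elements has isotropy group $G_{(m+1,1)}(p)$. (2) $\begin{pmatrix} x & 0 \\ 0 & w \end{pmatrix}$, with $x\in(k[t]/p^{m+1})^*$ and $w\in k[t]/p$. Each of these elements has isotropy group $\left\{\begin{pmatrix} a & 0 \\ 0 & d \end{pmatrix}\;\middle|\;a\in(k[t]/p^{m+1})^*,\ d\in(k[t]/p)^*\right\}$. (3) $\begin{pmatrix} x & 1 \\ z & w \end{pmatrix}$, with $x\in k[t]/p^m$ such that $p\mid x$, and $z,w\in k[t]/p$. Each of these elements has isotropy group $\left\{\begin{pmatrix} a & p^m b \\ b z & a \end{pmatrix}\;\middle|\;a\in(k[t]/p^{m+1})^*,\ b\in k[t]/p\right\}$. (4) $\begin{pmatrix} x & 0 \\ 1 & w \end{pmatrix}$, with $x\in k[t]/p^m$ such that $p\mid x$, and $w\in k[t]/p$. Each of these elements has isotropy group $\left\{\begin{pmatrix} a & 0 \\ c & a \end{pmatrix}\;\middle|\;a\in(k[t]/p^{m+1})^*,\ c\in k[t]/p\right\}$. In (3) and (4), "$x\in k[t]/p^m$" means that $x$ runs over a fixed set of representatives in $k[t]/p^{m+1}$ of the residue classes modulo $p^m$ that are divisible by $p$.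
   Context: Let $\lambda=(m+1,1)$, $M_\lambda(p)=k[t]/p^{m+1}\oplus k[t]/p$, $G_\lambda(p)=\mathrm{Aut}_{k[t]}(M_\lambda(p))$, $E_\lambda(p)=\mathrm{Ext}^1_{k[t]}(M_\lambda(p),M_\lambda(p))$, with $G_\lambda(p)$ acting on $E_\lambda(p)$ diagonally ($g\cdot\xi\cdot g^{-1}$, by functoriality in both arguments). In matrix terms: $$E_\lambda(p)=\left\{\begin{pmatrix} x & y \\ z & w \end{pmatrix}\;\middle|\;x\in k[t]/p^{m+1},\ y,z,w\in k[t]/p\right\},$$ $$G_\lambda(p)=\left\{\begin{pmatrix} a & p^m b \\ c & d \end{pmatrix}\;\middle|\;a\in(k[t]/p^{m+1})^*,\ b,c\in k[t]/p,\ d\in(k[t]/p)^*\right\}$$ (the matrix of an automorphism $g$ is given by $g(e_j)=\sum_ig_{ij}e_i$, $e_1,e_2$ being the images of $1$ in the two summands; the matrix of an extension $0\to M_\lambda\xrightarrow{i}M\xrightarrow{q}M_\lambda\to0$ is $(\epsilon_{ij})$ where $p^{\lambda_j}\tilde f_j=\sum_i\epsilon_{ij}i(e_i)$ for lifts $\tilde f_j\in M$ of $e_j$). For $g=\begin{pmatrix} a & p^m b \\ c & d \end{pmatrix}$ put $g^\#=\begin{pmatrix} a & b \\ p^m c & d \end{pmatrix}$. The action of $g$ on $E_\lambda(p)$ is $E\mapsto gE(g^{-1})^\#$; thus $g$ sends $E$ to $E'$ iff $gE=E'g^\#$ in $E_\lambda(p)$ (the $(1,1)$ entry is read modulo $p^{m+1}$,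 the others modulo $p$). When an element of $k[t]/p^{m+1}$ appears in an entry read modulo $p$, its residue class is meant. *)

theory Defs
  imports
    "HOL-Algebra.Group_Action"
    "HOL-Algebra.Module"
    "HOL-Algebra.Algebraic_Closure_Type"
    "HOL-Computational_Algebra.Polynomial"
begin

section \<open>Modules, automorphism groups, Yoneda extensions\<close>

definition mod_hom ::
  "('r, 'z) ring_scheme \<Rightarrow> ('r, 'a, 'c) module_scheme \<Rightarrow> ('r, 'b, 'd) module_scheme \<Rightarrow> ('a \<Rightarrow> 'b) set"
  where "mod_hom R M N = {h \<in> carrier M \<rightarrow> carrier N.
    (\<forall>x\<in>carrier M. \<forall>y\<in>carrier M. h (x \<oplus>\<^bsub>M\<^esub> y) = h x \<oplus>\<^bsub>N\<^esub> h y) \<and>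
    (\<forall>r\<in>carrier R. \<forall>x\<in>carrier M. h (r \<odot>\<^bsub>M\<^esub> x) = r \<odot>\<^bsub>N\<^esub> h x)}"

(* The module analogue of AutoGroup; as there, automorphisms are extensional functions. *)
definition mod_AutoGroup ::
  "('r, 'z) ring_scheme \<Rightarrow> ('r, 'a, 'c) module_scheme \<Rightarrow> ('a \<Rightarrow> 'a) monoid"
  where "mod_AutoGroup R M =
    BijGroup (carrier M) \<lparr>carrier := mod_hom R M M \<inter> Bij (carrier M)\<rparr>"

(* The mult and one fields of a module record play no role for the module structure;
   they are filled with the componentwise operations. *)
definition mod_dsum ::
  "('r, 'a, 'c) module_scheme \<Rightarrow> ('r, 'b, 'd) module_scheme \<Rightarrow> ('r, 'a \<times> 'b) module"
  where "mod_dsum M N =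
    \<lparr>carrier = carrier M \<times> carrier N,
     monoid.mult = (\<lambda>(x, y) (x', y'). (x \<otimes>\<^bsub>M\<^esub> x', y \<otimes>\<^bsub>N\<^esub> y')),
     monoid.one = (\<one>\<^bsub>M\<^esub>, \<one>\<^bsub>N\<^esub>),
     ring.zero = (\<zero>\<^bsub>M\<^esub>, \<zero>\<^bsub>N\<^esub>),
     ring.add = (\<lambda>(x, y) (x', y'). (x \<oplus>\<^bsub>M\<^esub> x', y \<oplus>\<^bsub>N\<^esub> y')),
     module.smult = (\<lambda>r (x, y). (r \<odot>\<^bsub>M\<^esub> x, r \<odot>\<^bsub>N\<^esub> y))\<rparr>"

(* (Y, i, q) stands for a short sequence  0 --> B --i--> Y --q--> A --> 0. *)
type_synonym ('r, 'b, 'x, 'a) extn = "('r, 'x) module \<times> ('b \<Rightarrow> 'x) \<times> ('x \<Rightarrow> 'a)"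

definition extensions ::
  "('r, 'z) ring_scheme \<Rightarrow> ('r, 'a, 'c) module_scheme \<Rightarrow> ('r, 'b, 'd) module_scheme
    \<Rightarrow> ('r, 'b, 'x, 'a) extn set"
  where "extensions R A B = {(Y, i, q).
    module R Y \<and> i \<in> mod_hom R B Y \<and> q \<in> mod_hom R Y A \<and>
    inj_on i (carrier B) \<and> q ` carrier Y = carrier A \<and>
    i ` carrier B = {x \<in> carrier Y. q x = \<zero>\<^bsub>A\<^esub>}}"

(* (\<alpha>, \<phi>, \<beta>) is a morphism from the first extension (with submodule B) to the second one. *)
fun extn_mor ::
  "('r, 'z) ring_scheme \<Rightarrow> ('r, 'b, 'd) module_scheme
    \<Rightarrow> ('b \<Rightarrow> 'b2) \<Rightarrow> ('x \<Rightarrow> 'x2) \<Rightarrow> ('a \<Rightarrow> 'a2)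
    \<Rightarrow> ('r, 'b, 'x, 'a) extn \<Rightarrow> ('r, 'b2, 'x2, 'a2) extn \<Rightarrow> bool"
  where "extn_mor R B \<alpha> \<phi> \<beta> (Y, i, q) (Y', i', q') \<longleftrightarrow>
    \<phi> \<in> mod_hom R Y Y' \<and>
    (\<forall>u\<in>carrier B. \<phi> (i u) = i' (\<alpha> u)) \<and>
    (\<forall>x\<in>carrier Y. q' (\<phi> x) = \<beta> (q x))"

definition extn_equiv ::
  "('r, 'z) ring_scheme \<Rightarrow> ('r, 'a, 'c) module_scheme \<Rightarrow> ('r, 'b, 'd) module_scheme
    \<Rightarrow> ('r, 'b, 'x, 'a) extn rel"
  where "extn_equiv R A B = {(\<xi>, \<xi>').
    \<xi> \<in> extensions R A B \<and> \<xi>' \<in> extensions R A B \<and>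
    (\<exists>\<phi>. extn_mor R B id \<phi> id \<xi> \<xi>')}"

(* Ext^1(A, B) as the set of equivalence classes of extensions of A by B whose middle term
   lives in the type 'x.  Nothing is lost when 'x is the type of pairs of elements of B and A,
   since the middle term of an extension is in bijection with carrier B \<times> carrier A. *)
definition Ext1 ::
  "('r, 'z) ring_scheme \<Rightarrow> ('r, 'a, 'c) module_scheme \<Rightarrow> ('r, 'b, 'd) module_scheme
    \<Rightarrow> ('r, 'b, 'x, 'a) extn set set"
  where "Ext1 R A B = extensions R A B // extn_equiv R A B"

(* Functoriality of Ext^1 in both arguments.  For h : B --> B', the class h \<xi> of the pushout of
   \<xi> along h consists of the targets of the morphisms of extensions (h, \<phi>, id) out of \<xi>;
   for h : A' --> A, the class \<xi> h of the pullback of \<xi> along h consists of the sources of the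
   morphisms of extensions (id, \<phi>, h) into \<xi>. *)
definition ext_push ::
  "('r, 'z) ring_scheme \<Rightarrow> ('r, 'a, 'c) module_scheme
    \<Rightarrow> ('r, 'b, 'd) module_scheme \<Rightarrow> ('r, 'b2, 'd2) module_scheme
    \<Rightarrow> ('b \<Rightarrow> 'b2) \<Rightarrow> ('r, 'b, 'x, 'a) extn set \<Rightarrow> ('r, 'b2, 'x, 'a) extn set"
  where "ext_push R A B B' h C =
    {\<xi>' \<in> extensions R A B'. \<exists>\<xi>\<in>C. \<exists>\<phi>. extn_mor R B h \<phi> id \<xi> \<xi>'}"

definition ext_pull ::
  "('r, 'z) ring_scheme \<Rightarrow> ('r, 'a2, 'c2) module_scheme \<Rightarrow> ('r, 'b, 'd) module_scheme
    \<Rightarrow> ('a2 \<Rightarrow> 'a) \<Rightarrow> ('r, 'b, 'x, 'a) extn set \<Rightarrow> ('r, 'b, 'x, 'a2) extn set"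
  where "ext_pull R A' B h C =
    {\<xi>' \<in> extensions R A' B. \<exists>\<xi>\<in>C. \<exists>\<phi>. extn_mor R B id \<phi> h \<xi>' \<xi>}"

definition ext_act ::
  "('r, 'z) ring_scheme \<Rightarrow> ('r, 'a, 'c) module_scheme
    \<Rightarrow> ('a \<Rightarrow> 'a) \<Rightarrow> ('r, 'a, 'x, 'a) extn set \<Rightarrow> ('r, 'a, 'x, 'a) extn set"
  where "ext_act R M g = (\<lambda>C\<in>Ext1 R M M.
    ext_pull R M M (inv\<^bsub>mod_AutoGroup R M\<^esub> g) (ext_push R M M M g C))"


section \<open>The case of the partition (m + 1, 1)\<close>

abbreviation kt :: "'k::field poly ring"
  where "kt \<equiv> ring_of_type_algebra"

(* k[t]/(q), both as a ring and as a k[t]-module, carried by the remainders modulo q. *)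
definition poly_quot :: "'k::field poly \<Rightarrow> ('k poly, 'k poly) module"
  where "poly_quot q =
    \<lparr>carrier = {f. f mod q = f},
     monoid.mult = (\<lambda>f g. (f * g) mod q),
     monoid.one = 1 mod q,
     ring.zero = 0,
     ring.add = (\<lambda>f g. (f + g) mod q),
     module.smult = (\<lambda>r f. (r * f) mod q)\<rparr>"

definition M_lam :: "'k::field poly \<Rightarrow> nat \<Rightarrow> ('k poly, 'k poly \<times> 'k poly) module"
  where "M_lam p m = mod_dsum (poly_quot (p ^ (m + 1))) (poly_quot p)"

definition G_lam :: "'k::field poly \<Rightarrow> nat \<Rightarrow> ('k poly \<times> 'k poly \<Rightarrow> 'k poly \<times> 'k poly) monoid"
  where "G_lam p m = mod_AutoGroup kt (M_lam p m)"

type_synonym 'k lam_extn =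
  "('k poly, 'k poly \<times> 'k poly, ('k poly \<times> 'k poly) \<times> ('k poly \<times> 'k poly), 'k poly \<times> 'k poly) extn"

definition E_lam :: "'k::field poly \<Rightarrow> nat \<Rightarrow> 'k lam_extn set set"
  where "E_lam p m = Ext1 kt (M_lam p m) (M_lam p m)"

definition act_lam ::
  "'k::field poly \<Rightarrow> nat \<Rightarrow> ('k poly \<times> 'k poly \<Rightarrow> 'k poly \<times> 'k poly)
    \<Rightarrow> 'k lam_extn set \<Rightarrow> 'k lam_extn set"
  where "act_lam p m = ext_act kt (M_lam p m)"

(* Mat2 x y z w has rows (x, y) and (z, w). *)
datatype 'a mat2 = Mat2 'a 'a 'a 'a

(* The generators e_1, e_2 of M_lam p m are (1, 0) and (0, 1); the j-th column of the matrix of g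
   consists of the coordinates of g e_j. *)
definition aut_matrix :: "('k::field poly \<times> 'k poly \<Rightarrow> 'k poly \<times> 'k poly) \<Rightarrow> 'k poly mat2"
  where "aut_matrix g =
    Mat2 (fst (g (1, 0))) (fst (g (0, 1))) (snd (g (1, 0))) (snd (g (0, 1)))"

(* f1, f2 are lifts of e_1, e_2. *)
fun ext_has_matrix :: "'k::field poly \<Rightarrow> nat \<Rightarrow> 'k lam_extn \<Rightarrow> 'k poly mat2 \<Rightarrow> bool"
  where "ext_has_matrix p m (Y, i, q) (Mat2 x y z w) \<longleftrightarrow>
    (\<exists>f1\<in>carrier Y. \<exists>f2\<in>carrier Y. q f1 = (1, 0) \<and> q f2 = (0, 1) \<and>
      p ^ (m + 1) \<odot>\<^bsub>Y\<^esub> f1 = x \<odot>\<^bsub>Y\<^esub> i (1, 0) \<oplus>\<^bsub>Y\<^esub> z \<odot>\<^bsub>Y\<^esub> i (0, 1) \<and>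
      p \<odot>\<^bsub>Y\<^esub> f2 = y \<odot>\<^bsub>Y\<^esub> i (1, 0) \<oplus>\<^bsub>Y\<^esub> w \<odot>\<^bsub>Y\<^esub> i (0, 1))"

(* The element of E_lam p m with a given matrix, i.e. the set of all extensions with that matrix. *)
definition ext_of_matrix :: "'k::field poly \<Rightarrow> nat \<Rightarrow> 'k poly mat2 \<Rightarrow> 'k lam_extn set"
  where "ext_of_matrix p m A =
    {\<xi> \<in> extensions kt (M_lam p m) (M_lam p m). ext_has_matrix p m \<xi> A}"

end

theory Submission
  imports Defs "HOL-Library.Product_Plus"
begin

text \<open>
  Write \<open>P = p^(m+1)\<close>, let \<open>M\<close> be the module $k[t]/P \oplus k[t]/p$ and write
  $E = (x, y; z, w)$ for a matrix. The proof translates everything into congruences modulo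
  \<open>P\<close> and \<open>p\<close>.

  An extension of \<open>M\<close> by \<open>M\<close> with lifts \<open>f1\<close>, \<open>f2\<close> of the
  two generators is generated by \<open>i (1, 0)\<close>, \<open>i (0, 1)\<close>, \<open>f1\<close>,
  \<open>f2\<close>, and the only relations are the obvious ones: \<open>P\<close> and \<open>p\<close> kill
  the first two generators, and \<open>P f1\<close>, \<open>p f2\<close> are the combinations of them
  that the matrix prescribes (\<open>L_eq_zero_iff\<close>). From this presentation one reads off which
  morphisms exist. An endomorphism \<open>g\<close> of \<open>M\<close> extends to a morphism between two
  extensions, acting as \<open>g\<close> on both ends, iff the matrices satisfy $g E = E' g^\#$ entrywise
  (\<open>intertwines_if_morphism\<close>, \<open>morphism_if_intertwines\<close>). For \<open>g = 1\<close>
  this says that the classes in $\mathrm{Ext}^1$ are the sets of extensions with a given matrix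
  (\<open>E_lam_iff\<close>). For an automorphism \<open>g\<close>, the five lemma
  (\<open>extn_mor_inverse\<close>) merges the pushout along \<open>g\<close> and the pullback along
  its inverse into one morphism acting as \<open>g\<close> on both ends (\<open>ext_act_eq\<close>), so
  \<open>g\<close> sends the class of \<open>E\<close> to that of \<open>E'\<close> iff $g E = E' g^\#$
  (\<open>act_lam_eq_iff\<close>). Automorphisms are the matrices \<open>(a, p^m b; c, d)\<close>
  with \<open>a\<close> and \<open>d\<close> prime to \<open>p\<close>.

  What remains is to solve the congruences. If \<open>p\<close> does not divide \<open>x\<close>, the
  off-diagonal entries can be cleared. If \<open>p\<close> divides \<open>x\<close>, then \<open>y\<close>
  and \<open>z\<close> only change by unit factors modulo \<open>p\<close>: either both vanish and
  everything acts trivially, or one of them can be scaled to \<open>1\<close>, after which the remaining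
  freedom moves \<open>x\<close> by multiples of \<open>p^m\<close> at the expense of \<open>w\<close>
  (\<open>linked_to_representative\<close>). The same congruences give uniqueness
  (\<open>linked_representatives_eq\<close>) and the stabilizers.
\<close>

section \<open>Inverses modulo powers of an irreducible polynomial\<close>

text \<open>Bezout: a nonzero element of least degree in the ideal generated by \<open>a\<close> and
  \<open>p\<close> divides both of them, and irreducibility of \<open>p\<close> makes it a unit.\<close>

lemma irreducible_poly_inverse:
  fixes p a :: "'k::field poly"
  assumes irr: "Factorial_Ring.irreducible p" and ndvd: "\<not> p dvd a"
  shows "\<exists>a'. p dvd a * a' - 1"
proof -
  let ?I = "{e. e \<noteq> 0 \<and> (\<exists>r s. e = a * r + p * s)}"
  have "a = a * 1 + p * 0" by simp
  moreover have "a \<noteq> 0" using ndvd by auto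
  ultimately have "a \<in> ?I" by blast
  then obtain e where e: "e \<in> ?I" and least: "\<And>f. f \<in> ?I \<Longrightarrow> degree e \<le> degree f"
    using ex_has_least_nat[of "\<lambda>e. e \<in> ?I" a degree] by blast
  obtain r s where rs: "e = a * r + p * s" using e by auto
  have mem: "e dvd a * u + p * v" for u v
  proof -
    let ?f = "a * u + p * v"
    have comb: "?f - e * t = a * (u - r * t) + p * (v - s * t)" for t
      by (simp add: rs algebra_simps)
    have "?f mod e = ?f - e * (?f div e)"
      by (simp add: minus_mult_div_eq_mod)
    also have "\<dots> = a * (u - r * (?f div e)) + p * (v - s * (?f div e))"
      by (rule comb)
    finally have "?f mod e = 0 \<or> ?f mod e \<in> ?I" by blast
    moreover have "?f mod e \<noteq> 0 \<Longrightarrow> degree (?f mod e) < degree e"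
      using degree_mod_less[of e ?f] e by auto
    ultimately show ?thesis
      using least[of "?f mod e"] unfolding dvd_eq_mod_eq_0 by linarith
  qed
  have ea: "e dvd a" using mem[of 1 0] by simp
  have "e dvd p" using mem[of 0 1] by simp
  then obtain f where f: "p = e * f" by (elim dvdE)
  have "\<not> f dvd 1"
  proof
    assume "f dvd 1"
    then have "p dvd e" by (simp add: f)
    then show False using ea ndvd dvd_trans by blast
  qed
  then have "e dvd 1" using irr f by (auto simp: Factorial_Ring.irreducible_def)
  then obtain g where "1 = e * g" by (elim dvdE)
  then have "a * (r * g) - 1 = p * (- s * g)" by (simp add: rs algebra_simps)
  then show ?thesis by (metis dvd_triv_left)
qed

text \<open>If \<open>a b\<close> and \<open>a c\<close> are congruent to \<open>1\<close> modulo \<open>p\<close> and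
  \<open>p^n\<close>, then the product \<open>(a b - 1) (a c - 1)\<close> vanishes modulo
  \<open>p^(n+1)\<close>, and up to sign it is again of the form \<open>a e - 1\<close>.\<close>

lemma irreducible_power_inverse:
  fixes p a :: "'k::field poly"
  assumes "Factorial_Ring.irreducible p" and "\<not> p dvd a"
  shows "\<exists>a'. p ^ n dvd a * a' - 1"
proof -
  obtain b where b: "p dvd a * b - 1" using irreducible_poly_inverse[OF assms] by blast
  show ?thesis
  proof (induction n)
    case (Suc n)
    then obtain c where c: "p ^ n dvd a * c - 1" by blast
    have "p ^ Suc n dvd (a * b - 1) * (a * c - 1)" using mult_dvd_mono[OF b c] by simp
    also have "(a * b - 1) * (a * c - 1) = - (a * (b + c - a * b * c) - 1)"
      by (simp add: algebra_simps)
    finally show ?case by (metis dvd_minus_iff)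
  qed simp
qed

lemma carrier_poly_quot: "f \<in> carrier (poly_quot q) \<longleftrightarrow> f mod q = f"
  by (simp add: poly_quot_def)

lemma Units_poly_quot_power:
  fixes p a :: "'k::field poly"
  assumes "Factorial_Ring.irreducible p" and "n \<ge> 1"
  shows "a \<in> Units (poly_quot (p ^ n)) \<longleftrightarrow> a mod p ^ n = a \<and> \<not> p dvd a"
proof
  assume "a \<in> Units (poly_quot (p ^ n))"
  then obtain b where "a mod p ^ n = a" "(a * b) mod p ^ n = 1 mod p ^ n"
    by (auto simp: Units_def poly_quot_def mult.commute)
  then have "p dvd a * b - 1"
    using \<open>n \<ge> 1\<close> by (metis mod_eq_dvd_iff dvd_power dvd_trans zero_less_one order_less_le_trans)
  moreover have "\<not> p dvd 1" using assms(1) by (simp add: Factorial_Ring.irreducible_def)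
  ultimately have "\<not> p dvd a"
    by (metis diff_diff_eq2 add_diff_cancel_left' dvd_diff dvd_mult2 diff_add_cancel add.commute)
  with \<open>a mod p ^ n = a\<close> show "a mod p ^ n = a \<and> \<not> p dvd a" ..
next
  assume a: "a mod p ^ n = a \<and> \<not> p dvd a"
  then obtain b where "p ^ n dvd a * b - 1" using irreducible_power_inverse[OF assms(1)] by blast
  then have "(a * (b mod p ^ n)) mod p ^ n = 1 mod p ^ n"
    by (simp add: mod_eq_dvd_iff mod_mult_right_eq)
  then show "a \<in> Units (poly_quot (p ^ n))"
    using a by (auto simp: Units_def poly_quot_def mult.commute[of _ a] intro!: exI[of _ "b mod p ^ n"])
qed

text \<open>The carries in the quotient when a sum or a product is reduced modulo \<open>q\<close>.\<close>

lemma div_carry: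
  fixes r r' t q :: "'k::field poly"
  shows "(r + r') div q = r div q + (r mod q + r') div q"
    and "(t * r) div q = t * (r div q) + (t * (r mod q)) div q"
proof -
  show "(r + r') div q = r div q + (r mod q + r') div q"
  proof (cases "q = 0")
    case False
    have "r + r' = (r mod q + r') + q * (r div q)" by (simp add: algebra_simps)
    then show ?thesis using False by (metis add.commute div_mult_self2)
  qed simp
  show "(t * r) div q = t * (r div q) + (t * (r mod q)) div q"
  proof (cases "q = 0")
    case False
    have "t * r = t * (r mod q) + q * (t * (r div q))"
      by (metis add.commute distrib_left mod_mult_div_eq mult.left_commute)
    then show ?thesis using False by (metis add.commute div_mult_self2)
  qed simp
qed

section \<open>Modules over the polynomial ring\<close>

lemma kt_simps [simp]:
  "carrier kt = UNIV" "r \<oplus>\<^bsub>kt\<^esub> s = r + s" "r \<otimes>\<^bsub>kt\<^esub> s = r * s" "\<one>\<^bsub>kt\<^esub> = 1" "\<zero>\<^bsub>kt\<^esub> = 0"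
  by (simp_all add: ring_of_type_algebra_def)

text \<open>A quotient of a module can be carried by normal forms. The function \<open>N\<close> picks one element
  of each class; the two conditions on \<open>N\<close> say that addition and scalar multiplication
  descend to the classes.\<close>

lemma module_of_normal_form:
  fixes N :: "'b::ab_group_add \<Rightarrow> 'b" and sm :: "'k::field poly \<Rightarrow> 'b \<Rightarrow> 'b"
    and Y :: "('k poly, 'b, 'c) module_scheme"
  assumes sm: "\<And>r s x. sm (r + s) x = sm r x + sm s x" "\<And>r x y. sm r (x + y) = sm r x + sm r y"
      "\<And>r s x. sm (r * s) x = sm r (sm s x)" "\<And>x. sm 1 x = x"
    and N: "\<And>x y. N (N x + y) = N (x + y)" "\<And>r x. N (sm r (N x)) = N (sm r x)"
    and Y: "carrier Y = range N" "\<And>x y. x \<oplus>\<^bsub>Y\<^esub> y = N (x + y)" "\<zero>\<^bsub>Y\<^esub> = N 0"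
      "\<And>r x. r \<odot>\<^bsub>Y\<^esub> x = N (sm r x)"
  shows "module kt Y"
proof -
  have N': "N (x + N y) = N (x + y)" for x y
    using N(1)[of y x] by (simp add: add.commute)
  have NN: "N (N x) = N x" for x using N(1)[of x 0] by simp
  show ?thesis
  proof (rule moduleI)
    show "cring kt" by (rule cring_from_type_algebra)
    show "abelian_group Y"
    proof (rule abelian_groupI)
      fix x assume "x \<in> carrier Y"
      then show "\<exists>y\<in>carrier Y. y \<oplus>\<^bsub>Y\<^esub> x = \<zero>\<^bsub>Y\<^esub>"
        by (auto simp: Y N N' intro!: exI[of _ "- x"])
    qed (auto simp: Y N N' NN add_ac)
  qed (auto simp: Y N N' NN sm)
qed

lemma module_poly_quot_dsum:
  fixes P Q :: "'k::field poly"
  shows "module kt (mod_dsum (poly_quot P) (poly_quot Q))"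
proof (rule module_of_normal_form[where N = "\<lambda>(u, v). (u mod P, v mod Q)"
        and sm = "\<lambda>r (u, v). (r * u, r * v)"])
  show "carrier (mod_dsum (poly_quot P) (poly_quot Q)) = range (\<lambda>(u, v). (u mod P, v mod Q))"
    by (auto simp: mod_dsum_def poly_quot_def) (metis (mono_tags) case_prod_conv rangeI)
qed (auto simp: mod_dsum_def poly_quot_def zero_prod_def algebra_simps mod_simps)

definition lin_comb ::
  "('r, 'x, 'c) module_scheme \<Rightarrow> 'x \<Rightarrow> 'x \<Rightarrow> 'x \<Rightarrow> 'x \<Rightarrow> 'r \<Rightarrow> 'r \<Rightarrow> 'r \<Rightarrow> 'r \<Rightarrow> 'x"
  where "lin_comb Y a b c d u v r s =
    (u \<odot>\<^bsub>Y\<^esub> a \<oplus>\<^bsub>Y\<^esub> v \<odot>\<^bsub>Y\<^esub> b) \<oplus>\<^bsub>Y\<^esub> (r \<odot>\<^bsub>Y\<^esub> c \<oplus>\<^bsub>Y\<^esub> s \<odot>\<^bsub>Y\<^esub> d)"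

lemma
  fixes Y :: "('k::field poly, 'x, 'c) module_scheme"
  assumes Y: "module kt Y" and gen: "{a, b, c, d} \<subseteq> carrier Y"
  shows lin_comb_closed: "lin_comb Y a b c d u v r s \<in> carrier Y"
    and lin_comb_add: "lin_comb Y a b c d u v r s \<oplus>\<^bsub>Y\<^esub> lin_comb Y a b c d u' v' r' s'
          = lin_comb Y a b c d (u + u') (v + v') (r + r') (s + s')"
    and lin_comb_smult: "t \<odot>\<^bsub>Y\<^esub> lin_comb Y a b c d u v r s
          = lin_comb Y a b c d (t * u) (t * v) (t * r) (t * s)"
    and lin_comb_zero: "lin_comb Y a b c d 0 0 0 0 = \<zero>\<^bsub>Y\<^esub>"
proof -
  interpret Y: module kt Y by (rule Y)
  have cl: "r \<odot>\<^bsub>Y\<^esub> x \<in> carrier Y" if "x \<in> carrier Y" for r x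
    using Y.smult_closed that by simp
  have l: "(r + s) \<odot>\<^bsub>Y\<^esub> x = r \<odot>\<^bsub>Y\<^esub> x \<oplus>\<^bsub>Y\<^esub> s \<odot>\<^bsub>Y\<^esub> x" if "x \<in> carrier Y" for r s x
    using Y.smult_l_distr[of r s x] that by simp
  have a: "(r * s) \<odot>\<^bsub>Y\<^esub> x = r \<odot>\<^bsub>Y\<^esub> (s \<odot>\<^bsub>Y\<^esub> x)" if "x \<in> carrier Y" for r s x
    using Y.smult_assoc1[of r s x] that by simp
  show "lin_comb Y a b c d u v r s \<in> carrier Y" using gen by (simp add: lin_comb_def cl)
  show "lin_comb Y a b c d u v r s \<oplus>\<^bsub>Y\<^esub> lin_comb Y a b c d u' v' r' s'
          = lin_comb Y a b c d (u + u') (v + v') (r + r') (s + s')"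
    using gen by (simp add: lin_comb_def cl l Y.a_ac)
  show "t \<odot>\<^bsub>Y\<^esub> lin_comb Y a b c d u v r s = lin_comb Y a b c d (t * u) (t * v) (t * r) (t * s)"
    using gen by (simp add: lin_comb_def cl a Y.smult_r_distr)
  have "0 \<odot>\<^bsub>Y\<^esub> x = \<zero>\<^bsub>Y\<^esub>" if "x \<in> carrier Y" for x
    using Y.smult_l_null[of x] that by simp
  then show "lin_comb Y a b c d 0 0 0 0 = \<zero>\<^bsub>Y\<^esub>" using gen by (simp add: lin_comb_def)
qed

section \<open>Homomorphisms, the five lemma and the action on extensions\<close>

lemma mod_homD:
  assumes "h \<in> mod_hom R M N"
  shows mod_hom_closed: "x \<in> carrier M \<Longrightarrow> h x \<in> carrier N"
    and mod_hom_add: "x \<in> carrier M \<Longrightarrow> y \<in> carrier M \<Longrightarrow> h (x \<oplus>\<^bsub>M\<^esub> y) = h x \<oplus>\<^bsub>N\<^esub> h y"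
    and mod_hom_smult: "r \<in> carrier R \<Longrightarrow> x \<in> carrier M \<Longrightarrow> h (r \<odot>\<^bsub>M\<^esub> x) = r \<odot>\<^bsub>N\<^esub> h x"
  using assms by (auto simp: mod_hom_def)

lemma mod_hom_zero:
  assumes "h \<in> mod_hom R M N" "module R M" "module R N"
  shows "h \<zero>\<^bsub>M\<^esub> = \<zero>\<^bsub>N\<^esub>"
proof -
  interpret M: module R M by fact
  interpret N: module R N by fact
  have "h \<zero>\<^bsub>M\<^esub> \<oplus>\<^bsub>N\<^esub> h \<zero>\<^bsub>M\<^esub> = h \<zero>\<^bsub>M\<^esub>"
    using mod_hom_add[OF assms(1), of "\<zero>\<^bsub>M\<^esub>" "\<zero>\<^bsub>M\<^esub>"] by simp
  then show ?thesis using mod_hom_closed[OF assms(1), of "\<zero>\<^bsub>M\<^esub>"] by simp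
qed

definition inverse_endos :: "('r, 'z) ring_scheme \<Rightarrow> ('r, 'a, 'c) module_scheme
    \<Rightarrow> ('a \<Rightarrow> 'a) \<Rightarrow> ('a \<Rightarrow> 'a) \<Rightarrow> bool"
  where "inverse_endos R M g h \<longleftrightarrow> g \<in> mod_hom R M M \<and> h \<in> mod_hom R M M \<and>
    (\<forall>x\<in>carrier M. g (h x) = x \<and> h (g x) = x)"

lemma inverse_endos_id: "inverse_endos R M id id"
  by (simp add: inverse_endos_def mod_hom_def)

lemma inverse_endos_sym: "inverse_endos R M g h \<Longrightarrow> inverse_endos R M h g"
  by (simp add: inverse_endos_def)

lemma extensionsD:
  assumes "(Y, i, q) \<in> extensions R A B"
  shows "module R Y" "i \<in> mod_hom R B Y" "q \<in> mod_hom R Y A" "inj_on i (carrier B)"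
    "q ` carrier Y = carrier A" "i ` carrier B = {x \<in> carrier Y. q x = \<zero>\<^bsub>A\<^esub>}"
  using assms by (auto simp: extensions_def)

text \<open>The five lemma, by a diagram chase: if both outer maps are invertible, then \<open>\<phi>\<close> is
  bijective, and its inverse is the middle map of the inverse morphism.\<close>

lemma extn_mor_inverse:
  assumes M: "module R M"
    and ext: "\<xi> \<in> extensions R M M" "\<xi>' \<in> extensions R M M"
    and mor: "extn_mor R M \<alpha> \<phi> \<beta> \<xi> \<xi>'"
    and \<alpha>: "inverse_endos R M \<alpha> \<alpha>'" and \<beta>: "inverse_endos R M \<beta> \<beta>'"
  shows "\<exists>\<psi>. extn_mor R M \<alpha>' \<psi> \<beta>' \<xi>' \<xi>"
proof -
  obtain Y i q Y' i' q' where \<xi>: "\<xi> = (Y, i, q)" "\<xi>' = (Y', i', q')" by (metis prod_cases3)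
  note E = extensionsD[OF ext(1)[unfolded \<xi>]] and E' = extensionsD[OF ext(2)[unfolded \<xi>]]
  interpret M: module R M by (rule M)
  interpret Y: module R Y by (rule E)
  interpret Y': module R Y' by (rule E')
  have \<phi>: "\<phi> \<in> mod_hom R Y Y'" and \<phi>i: "\<And>u. u \<in> carrier M \<Longrightarrow> \<phi> (i u) = i' (\<alpha> u)"
    and q\<phi>: "\<And>x. x \<in> carrier Y \<Longrightarrow> q' (\<phi> x) = \<beta> (q x)"
    using mor \<xi> by auto
  have \<alpha>: "\<alpha> \<in> mod_hom R M M" "\<alpha>' \<in> mod_hom R M M"
      "\<And>x. x \<in> carrier M \<Longrightarrow> \<alpha> (\<alpha>' x) = x" "\<And>x. x \<in> carrier M \<Longrightarrow> \<alpha>' (\<alpha> x) = x"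
    and \<beta>: "\<beta> \<in> mod_hom R M M" "\<beta>' \<in> mod_hom R M M"
      "\<And>x. x \<in> carrier M \<Longrightarrow> \<beta> (\<beta>' x) = x" "\<And>x. x \<in> carrier M \<Longrightarrow> \<beta>' (\<beta> x) = x"
    using assms by (auto simp: inverse_endos_def)
  note closed = mod_hom_closed[OF \<phi>] mod_hom_closed[OF E(2)] mod_hom_closed[OF E(3)]
    mod_hom_closed[OF E'(2)] mod_hom_closed[OF E'(3)] mod_hom_closed[OF \<alpha>(1)]
    mod_hom_closed[OF \<alpha>(2)] mod_hom_closed[OF \<beta>(1)] mod_hom_closed[OF \<beta>(2)]
  note zero = mod_hom_zero[OF \<phi> E(1) E'(1)] mod_hom_zero[OF E(2) M E(1)] mod_hom_zero[OF E'(2) M E'(1)]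
    mod_hom_zero[OF E'(3) E'(1) M] mod_hom_zero[OF \<alpha>(2) M M] mod_hom_zero[OF \<beta>(2) M M]
  have ker: "x = \<zero>\<^bsub>Y\<^esub>" if x: "x \<in> carrier Y" "\<phi> x = \<zero>\<^bsub>Y'\<^esub>" for x
  proof -
    have "\<beta> (q x) = q' (\<phi> x)" using q\<phi>[OF x(1)] by simp
    also have "\<dots> = \<zero>\<^bsub>M\<^esub>" by (simp add: x zero)
    finally have "q x = \<zero>\<^bsub>M\<^esub>" using \<beta>(4)[of "q x"] x by (simp add: zero closed)
    then obtain u where u: "u \<in> carrier M" "x = i u" using E(6) x by blast
    then have "i' (\<alpha> u) = i' \<zero>\<^bsub>M\<^esub>" using x by (simp add: \<phi>i zero)
    then have "\<alpha> u = \<zero>\<^bsub>M\<^esub>" using E'(4) u by (simp add: inj_on_eq_iff closed)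
    then have "u = \<zero>\<^bsub>M\<^esub>" using \<alpha>(4)[OF u(1)] by (simp add: zero)
    then show ?thesis by (simp add: u zero)
  qed
  have "inj_on \<phi> (carrier Y)"
  proof (rule inj_onI)
    fix x y assume xy: "x \<in> carrier Y" "y \<in> carrier Y" "\<phi> x = \<phi> y"
    let ?z = "x \<oplus>\<^bsub>Y\<^esub> (\<ominus>\<^bsub>Y\<^esub> y)"
    have z: "?z \<oplus>\<^bsub>Y\<^esub> y = x" "?z \<in> carrier Y"
      using xy by (simp_all add: Y.a_assoc Y.l_neg)
    then have "\<phi> ?z \<oplus>\<^bsub>Y'\<^esub> \<phi> y = \<phi> y" using mod_hom_add[OF \<phi>, of ?z y] xy by simp
    then have "\<phi> ?z = \<zero>\<^bsub>Y'\<^esub>" using xy z by (simp add: closed)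
    then show "x = y" using ker[OF z(2)] z(1) xy by simp
  qed
  moreover have "\<phi> ` carrier Y = carrier Y'"
  proof (intro equalityI subsetI)
    fix y assume y: "y \<in> carrier Y'"
    have "\<beta>' (q' y) \<in> q ` carrier Y" using E(5) y by (simp add: closed)
    then obtain x where x: "x \<in> carrier Y" "q x = \<beta>' (q' y)" by auto
    have q'x: "q' (\<phi> x) = q' y" using x y by (simp add: q\<phi> \<beta> closed)
    let ?z = "y \<oplus>\<^bsub>Y'\<^esub> (\<ominus>\<^bsub>Y'\<^esub> \<phi> x)"
    have z: "?z \<oplus>\<^bsub>Y'\<^esub> \<phi> x = y" "?z \<in> carrier Y'"
      using x y by (simp_all add: Y'.a_assoc Y'.l_neg closed)
    then have "q' ?z \<oplus>\<^bsub>M\<^esub> q' y = q' y"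
      using mod_hom_add[OF E'(3), of ?z "\<phi> x"] x q'x by (simp add: closed)
    then have "q' ?z = \<zero>\<^bsub>M\<^esub>" using y z by (simp add: closed)
    then obtain u where u: "u \<in> carrier M" "?z = i' u" using E'(6) z by blast
    then have "?z = \<phi> (i (\<alpha>' u))" by (simp add: \<phi>i closed \<alpha>)
    then have "y = \<phi> (i (\<alpha>' u) \<oplus>\<^bsub>Y\<^esub> x)"
      using z(1) mod_hom_add[OF \<phi>, of "i (\<alpha>' u)" x] u x by (simp add: closed)
    then show "y \<in> \<phi> ` carrier Y" using u x by (simp add: closed)
  qed (auto simp: closed)
  ultimately have bij: "bij_betw \<phi> (carrier Y) (carrier Y')" by (simp add: bij_betw_def)
  define \<psi> where "\<psi> = inv_into (carrier Y) \<phi>"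
  have \<psi>\<phi>: "\<psi> (\<phi> x) = x" if "x \<in> carrier Y" for x
    using bij that by (simp add: \<psi>_def bij_betw_def)
  have \<phi>_cases: "\<exists>x\<in>carrier Y. y = \<phi> x" if "y \<in> carrier Y'" for y
    using bij that by (auto simp: bij_betw_def)
  have "\<psi> \<in> mod_hom R Y' Y"
    unfolding mod_hom_def
  proof (intro CollectI conjI ballI)
    show "\<psi> \<in> carrier Y' \<rightarrow> carrier Y"
      using \<phi>_cases \<psi>\<phi> by (metis Pi_I)
    fix y assume "y \<in> carrier Y'"
    then obtain x where x: "x \<in> carrier Y" "y = \<phi> x" using \<phi>_cases by auto
    show "\<psi> (k \<odot>\<^bsub>Y'\<^esub> y) = k \<odot>\<^bsub>Y\<^esub> \<psi> y" if "k \<in> carrier R" for k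
      using that x mod_hom_smult[OF \<phi>, of k x, symmetric] by (simp add: \<psi>\<phi>)
    fix y' assume "y' \<in> carrier Y'"
    then obtain x' where x': "x' \<in> carrier Y" "y' = \<phi> x'" using \<phi>_cases by auto
    show "\<psi> (y \<oplus>\<^bsub>Y'\<^esub> y') = \<psi> y \<oplus>\<^bsub>Y\<^esub> \<psi> y'"
      using x x' mod_hom_add[OF \<phi>, of x x', symmetric] by (simp add: \<psi>\<phi>)
  qed
  moreover have "\<psi> (i' u) = i (\<alpha>' u)" if "u \<in> carrier M" for u
    using that \<phi>i[of "\<alpha>' u"] \<psi>\<phi>[of "i (\<alpha>' u)"] by (simp add: closed \<alpha>)
  moreover have "q (\<psi> y) = \<beta>' (q' y)" if "y \<in> carrier Y'" for y
    using \<phi>_cases[OF that] by (auto simp: \<psi>\<phi> q\<phi> \<beta> closed)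
  ultimately show ?thesis unfolding \<xi> by auto
qed

lemma extn_mor_comp:
  assumes "\<xi> \<in> extensions R M M" and "\<alpha> \<in> mod_hom R M M" and "extn_mor R M \<alpha> \<phi> \<beta> \<xi> \<xi>'"
    and "extn_mor R M \<alpha>' \<phi>' \<beta>' \<xi>' \<xi>''"
    and "\<And>x. x \<in> carrier M \<Longrightarrow> \<alpha>'' x = \<alpha>' (\<alpha> x)" "\<And>x. x \<in> carrier M \<Longrightarrow> \<beta>'' x = \<beta>' (\<beta> x)"
  shows "extn_mor R M \<alpha>'' (\<phi>' \<circ> \<phi>) \<beta>'' \<xi> \<xi>''"
proof -
  obtain Y i q Y' i' q' Y'' i'' q'' where
    \<xi>: "\<xi> = (Y, i, q)" "\<xi>' = (Y', i', q')" "\<xi>'' = (Y'', i'', q'')" by (metis prod_cases3)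
  have \<phi>: "\<phi> \<in> mod_hom R Y Y'" and \<phi>': "\<phi>' \<in> mod_hom R Y' Y''" using assms \<xi> by auto
  have "\<phi>' \<circ> \<phi> \<in> mod_hom R Y Y''"
    unfolding mod_hom_def
    by (auto simp: mod_homD[OF \<phi>] mod_homD[OF \<phi>'])
  then show ?thesis
    using assms mod_hom_closed[OF \<phi>] mod_hom_closed[OF assms(2)] \<xi>
      mod_hom_closed[of q R Y M] extensionsD(3)[of Y i q R M M] by auto
qed

lemma extn_mor_cong:
  assumes "\<xi> \<in> extensions R A B" "extn_mor R B \<alpha> \<phi> \<beta> \<xi> \<xi>'"
    and "\<And>t. t \<in> carrier B \<Longrightarrow> \<alpha> t = \<alpha>' t" "\<And>t. t \<in> carrier A \<Longrightarrow> \<beta> t = \<beta>' t"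
  shows "extn_mor R B \<alpha>' \<phi> \<beta>' \<xi> \<xi>'"
proof -
  obtain Y i q Y' i' q' where \<xi>: "\<xi> = (Y, i, q)" "\<xi>' = (Y', i', q')" by (metis prod_cases3)
  show ?thesis using assms \<xi> mod_hom_closed[OF extensionsD(3)[of Y i q R A B]] by auto
qed

lemma mod_AutoGroup_carrier:
  "g \<in> carrier (mod_AutoGroup R M) \<longleftrightarrow> g \<in> mod_hom R M M \<and> g \<in> Bij (carrier M)"
  by (simp add: mod_AutoGroup_def)

lemma mod_hom_inv_into:
  assumes M: "module R M" and g: "g \<in> mod_hom R M M" "g \<in> Bij (carrier M)"
  shows "restrict (inv_into (carrier M) g) (carrier M) \<in> mod_hom R M M"
proof -
  interpret M: module R M by fact
  have bij: "bij_betw g (carrier M) (carrier M)" using g by (simp add: Bij_def)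
  have inv: "inv_into (carrier M) g (g x) = x" if "x \<in> carrier M" for x
    using bij that by (simp add: bij_betw_def)
  have surj: "\<exists>x\<in>carrier M. y = g x" if "y \<in> carrier M" for y
    using bij that by (auto simp: bij_betw_def)
  show ?thesis
    unfolding mod_hom_def
  proof (intro CollectI conjI ballI)
    let ?h = "restrict (inv_into (carrier M) g) (carrier M)"
    have h: "?h (g x) = x" if "x \<in> carrier M" for x
      using that mod_hom_closed[OF g(1)] by (simp add: inv)
    show "?h \<in> carrier M \<rightarrow> carrier M" using Bij_inv_into_mem[OF g(2)] by auto
    fix y assume "y \<in> carrier M"
    then obtain x where x: "x \<in> carrier M" "y = g x" using surj by auto
    show "?h (k \<odot>\<^bsub>M\<^esub> y) = k \<odot>\<^bsub>M\<^esub> ?h y" if "k \<in> carrier R" for k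
      using that x h mod_hom_smult[OF g(1), of k x, symmetric] by (simp del: restrict_apply)
    fix y' assume "y' \<in> carrier M"
    then obtain x' where x': "x' \<in> carrier M" "y' = g x'" using surj by auto
    show "?h (y \<oplus>\<^bsub>M\<^esub> y') = ?h y \<oplus>\<^bsub>M\<^esub> ?h y'"
      using x x' h mod_hom_add[OF g(1), of x x', symmetric] by (simp del: restrict_apply)
  qed
qed

lemma subgroup_mod_AutoGroup:
  assumes M: "module R M"
  shows "subgroup (mod_hom R M M \<inter> Bij (carrier M)) (BijGroup (carrier M))"
proof (rule subgroup.intro)
  interpret M: module R M by fact
  show "mod_hom R M M \<inter> Bij (carrier M) \<subseteq> carrier (BijGroup (carrier M))"
    by (auto simp: BijGroup_def)
  show "\<one>\<^bsub>BijGroup (carrier M)\<^esub> \<in> mod_hom R M M \<inter> Bij (carrier M)"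
    by (auto simp: BijGroup_def id_Bij mod_hom_def)
  fix g assume g: "g \<in> mod_hom R M M \<inter> Bij (carrier M)"
  then show "inv\<^bsub>BijGroup (carrier M)\<^esub> g \<in> mod_hom R M M \<inter> Bij (carrier M)"
    using mod_hom_inv_into[OF M] by (auto simp: inv_BijGroup restrict_inv_into_Bij)
  fix h assume h: "h \<in> mod_hom R M M \<inter> Bij (carrier M)"
  have g': "g \<in> mod_hom R M M" and h': "h \<in> mod_hom R M M" using g h by auto
  have "compose (carrier M) g h \<in> mod_hom R M M"
    unfolding mod_hom_def by (auto simp: compose_eq mod_homD[OF g'] mod_homD[OF h'])
  then show "g \<otimes>\<^bsub>BijGroup (carrier M)\<^esub> h \<in> mod_hom R M M \<inter> Bij (carrier M)"
    using g h by (auto simp: BijGroup_def compose_Bij)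
qed

lemma group_mod_AutoGroup: "module R M \<Longrightarrow> group (mod_AutoGroup R M)"
  unfolding mod_AutoGroup_def
  using subgroup.subgroup_is_group[OF subgroup_mod_AutoGroup group_BijGroup] .

lemma mult_mod_AutoGroup:
  "g \<in> carrier (mod_AutoGroup R M) \<Longrightarrow> h \<in> carrier (mod_AutoGroup R M) \<Longrightarrow>
    g \<otimes>\<^bsub>mod_AutoGroup R M\<^esub> h = compose (carrier M) g h"
  by (simp add: mod_AutoGroup_def BijGroup_def)

lemma inverse_endos_inv:
  assumes M: "module R M" and g: "g \<in> carrier (mod_AutoGroup R M)"
  shows "inverse_endos R M g (inv\<^bsub>mod_AutoGroup R M\<^esub> g)"
proof -
  interpret G: group "mod_AutoGroup R M" by (rule group_mod_AutoGroup[OF M])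
  let ?h = "inv\<^bsub>mod_AutoGroup R M\<^esub> g"
  have "compose (carrier M) g ?h = (\<lambda>x\<in>carrier M. x)" "compose (carrier M) ?h g = (\<lambda>x\<in>carrier M. x)"
    using G.r_inv[OF g] G.l_inv[OF g] g mult_mod_AutoGroup[of _ R M] G.inv_closed[OF g]
    by (simp_all add: mod_AutoGroup_def BijGroup_def)
  then have "g (?h x) = x \<and> ?h (g x) = x" if "x \<in> carrier M" for x
    using that by (metis compose_eq restrict_apply')
  moreover have "g \<in> mod_hom R M M" "?h \<in> mod_hom R M M"
    using g G.inv_closed[OF g] by (simp_all add: mod_AutoGroup_carrier)
  ultimately show ?thesis by (simp add: inverse_endos_def)
qed

lemma Ext1_subset: "C \<in> Ext1 R A B \<Longrightarrow> C \<subseteq> extensions R A B"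
  by (auto simp: Ext1_def quotient_def extn_equiv_def)

text \<open>A morphism \<open>(g, \<phi>, id)\<close> into the pushout, followed by the inverse of the morphism
  \<open>(id, \<psi>, g\<inverse>)\<close> out of the pullback, is a morphism \<open>(g, \<chi>, g)\<close>.
  Conversely such a morphism factors through the extension in which the projection \<open>q\<close> is
  replaced by \<open>g\<inverse> \<circ> q\<close>. Hence one morphism describes the whole action.\<close>

lemma ext_act_eq:
  assumes M: "module R M" and g: "g \<in> carrier (mod_AutoGroup R M)" and C: "C \<in> Ext1 R M M"
  shows "ext_act R M g C =
    {\<xi>' \<in> extensions R M M. \<exists>\<xi>\<in>C. \<exists>\<phi>. extn_mor R M g \<phi> g \<xi> \<xi>'}" (is "_ = ?S")
proof -
  define h where "h = inv\<^bsub>mod_AutoGroup R M\<^esub> g"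
  have gh: "inverse_endos R M g h"
    unfolding h_def by (rule inverse_endos_inv[OF M g])
  then have g: "g \<in> mod_hom R M M" and h: "h \<in> mod_hom R M M"
    and gh1: "\<And>x. x \<in> carrier M \<Longrightarrow> g (h x) = x" and hg1: "\<And>x. x \<in> carrier M \<Longrightarrow> h (g x) = x"
    by (auto simp: inverse_endos_def)
  interpret M: module R M by fact
  have "ext_pull R M M h (ext_push R M M M g C) = ?S"
  proof (intro equalityI subsetI)
    fix \<xi>'' assume "\<xi>'' \<in> ext_pull R M M h (ext_push R M M M g C)"
    then obtain \<xi>' \<psi> where *: "\<xi>'' \<in> extensions R M M" "\<xi>' \<in> ext_push R M M M g C"
      "extn_mor R M id \<psi> h \<xi>'' \<xi>'"
      unfolding ext_pull_def by blast
    then obtain \<xi> \<phi> where **: "\<xi>' \<in> extensions R M M" "\<xi> \<in> C" "extn_mor R M g \<phi> id \<xi> \<xi>'"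
      unfolding ext_push_def by blast
    obtain \<chi> where \<chi>: "extn_mor R M id \<chi> g \<xi>' \<xi>''"
      using extn_mor_inverse[OF M *(1) **(1) *(3) inverse_endos_id inverse_endos_sym[OF gh]] by auto
    have "extn_mor R M g (\<chi> \<circ> \<phi>) g \<xi> \<xi>''"
      by (rule extn_mor_comp[OF _ g **(3) \<chi>]) (use **(2) Ext1_subset[OF C] in auto)
    then show "\<xi>'' \<in> ?S" using * ** by blast
  next
    fix \<xi>'' assume "\<xi>'' \<in> ?S"
    then obtain \<xi> \<phi> where *: "\<xi>'' \<in> extensions R M M" "\<xi> \<in> C" "extn_mor R M g \<phi> g \<xi> \<xi>''" by auto
    obtain Y i q Y'' i'' q'' where \<xi>: "\<xi> = (Y, i, q)" "\<xi>'' = (Y'', i'', q'')" by (metis prod_cases3)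
    note E'' = extensionsD[OF *(1)[unfolded \<xi>]]
    have E: "(Y, i, q) \<in> extensions R M M" using * \<xi> Ext1_subset[OF C] by auto
    \<comment> \<open>the intermediate extension through which the morphism factors\<close>
    let ?\<xi>' = "(Y'', i'', h \<circ> q'')"
    have h0: "h \<zero>\<^bsub>M\<^esub> = \<zero>\<^bsub>M\<^esub>" "g \<zero>\<^bsub>M\<^esub> = \<zero>\<^bsub>M\<^esub>"
      using mod_hom_zero[OF h M M] mod_hom_zero[OF g M M] .
    have "h \<circ> q'' \<in> mod_hom R Y'' M"
      unfolding mod_hom_def by (auto simp: mod_homD[OF h] mod_homD[OF E''(3)])
    moreover have "(h \<circ> q'') ` carrier Y'' = carrier M"
      unfolding image_comp[symmetric] E''(5) using mod_hom_closed[OF h] mod_hom_closed[OF g]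
      by (auto simp: image_iff) (metis hg1)
    moreover have "(h \<circ> q'') x = \<zero>\<^bsub>M\<^esub> \<longleftrightarrow> q'' x = \<zero>\<^bsub>M\<^esub>" if "x \<in> carrier Y''" for x
      using gh1[OF mod_hom_closed[OF E''(3) that]] h0 by auto
    ultimately have "?\<xi>' \<in> extensions R M M"
      using E'' unfolding extensions_def by auto
    moreover have "extn_mor R M g \<phi> id \<xi> ?\<xi>'"
      using *(3) \<xi> hg1 mod_hom_closed[OF extensionsD(3)[OF E]] by auto
    moreover have "extn_mor R M id id h \<xi>'' ?\<xi>'"
      using \<xi> by (auto simp: mod_hom_def)
    ultimately show "\<xi>'' \<in> ext_pull R M M h (ext_push R M M M g C)"
      using * unfolding ext_pull_def ext_push_def by blast
  qed
  then show ?thesis using C by (simp add: ext_act_def h_def)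
qed

section \<open>The module for the hook partition\<close>

locale hook_module =
  fixes p :: "'k::field poly" and m :: nat
  assumes irr: "Factorial_Ring.irreducible p" and m: "m \<ge> 1"
begin

definition "P = p ^ (m + 1)"
abbreviation "M \<equiv> M_lam p m"

lemma p_dvd_mult_iff: "p dvd a * b \<longleftrightarrow> p dvd a \<or> p dvd b"
proof
  assume ab: "p dvd a * b"
  show "p dvd a \<or> p dvd b"
  proof (rule disjCI)
    assume "\<not> p dvd b"
    then obtain c where "p dvd b * c - 1" using irreducible_poly_inverse[OF irr] by blast
    then have "p dvd c * (a * b) - a * (b * c - 1)" using ab dvd_diff dvd_mult by blast
    also have "c * (a * b) - a * (b * c - 1) = a" by (simp add: algebra_simps)
    finally show "p dvd a" .
  qed
qed auto

lemma p_nonzero: "p \<noteq> 0" and p_not_dvd_one: "\<not> p dvd 1"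
  using irr by (auto simp: Factorial_Ring.irreducible_def)

lemma p_dvd_P: "p dvd P" and P_dvd_imp: "P dvd a \<Longrightarrow> p dvd a"
proof -
  show "p dvd P" by (simp add: P_def)
  then show "P dvd a \<Longrightarrow> p dvd a" by (rule dvd_trans)
qed

lemma p_dvd_power: "p dvd p ^ m"
  using m by (simp add: dvd_power)

lemma P_dvd_power_mult_iff: "P dvd p ^ m * a \<longleftrightarrow> p dvd a"
  using p_nonzero by (simp add: P_def mult.commute[of p])

lemma one_mod: "1 mod p = 1" "1 mod P = 1"
proof -
  have "degree p \<noteq> 0"
    using irr by (auto simp: Factorial_Ring.irreducible_def is_unit_iff_degree)
  then show "1 mod p = 1" "1 mod P = 1"
    by (auto intro!: mod_poly_less simp: P_def degree_power_eq p_nonzero degree_mult_eq)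
qed

lemma M_simps [simp]:
  "carrier M = {(u, v). u mod P = u \<and> v mod p = v}"
  "(u, v) \<oplus>\<^bsub>M\<^esub> (u', v') = ((u + u') mod P, (v + v') mod p)"
  "r \<odot>\<^bsub>M\<^esub> (u, v) = ((r * u) mod P, (r * v) mod p)"
  "\<zero>\<^bsub>M\<^esub> = (0, 0)"
  by (auto simp: M_lam_def mod_dsum_def poly_quot_def P_def)

lemma module_M: "module kt M"
  unfolding M_lam_def by (rule module_poly_quot_dsum)

lemma generators_in_M: "(1, 0) \<in> carrier M" "(0, 1) \<in> carrier M"
  using one_mod by auto

lemma mod_hom_on_M:
  assumes "h \<in> mod_hom kt M N"
  shows "h (u mod P, v mod p) = u \<odot>\<^bsub>N\<^esub> h (1, 0) \<oplus>\<^bsub>N\<^esub> v \<odot>\<^bsub>N\<^esub> h (0, 1)"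
proof -
  have "h (u mod P, v mod p) = h (u \<odot>\<^bsub>M\<^esub> (1, 0) \<oplus>\<^bsub>M\<^esub> v \<odot>\<^bsub>M\<^esub> (0, 1))" by simp
  also have "\<dots> = u \<odot>\<^bsub>N\<^esub> h (1, 0) \<oplus>\<^bsub>N\<^esub> v \<odot>\<^bsub>N\<^esub> h (0, 1)"
    using mod_hom_add[OF assms, of "u \<odot>\<^bsub>M\<^esub> (1, 0)" "v \<odot>\<^bsub>M\<^esub> (0, 1)"]
      mod_hom_smult[OF assms _ generators_in_M(1), of u]
      mod_hom_smult[OF assms _ generators_in_M(2), of v] by simp
  finally show ?thesis .
qed
end

section \<open>Presentation of an extension with a given matrix\<close>

text \<open>An extension of \<open>M\<close> by \<open>M\<close>, with lifts \<open>f1\<close>, \<open>f2\<close> of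
  the generators of the quotient that exhibit \<open>(x, y; z, w)\<close> as its matrix.\<close>

locale extn_with_matrix = hook_module p m for p :: "'k::field poly" and m +
  fixes Y :: "('k poly, 'x) module" and i q f1 f2 x y z w
  assumes ext: "(Y, i, q) \<in> extensions kt M M"
    and f: "f1 \<in> carrier Y" "f2 \<in> carrier Y" "q f1 = (1, 0)" "q f2 = (0, 1)"
    and f1: "P \<odot>\<^bsub>Y\<^esub> f1 = x \<odot>\<^bsub>Y\<^esub> i (1, 0) \<oplus>\<^bsub>Y\<^esub> z \<odot>\<^bsub>Y\<^esub> i (0, 1)"
    and f2: "p \<odot>\<^bsub>Y\<^esub> f2 = y \<odot>\<^bsub>Y\<^esub> i (1, 0) \<oplus>\<^bsub>Y\<^esub> w \<odot>\<^bsub>Y\<^esub> i (0, 1)"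
begin

definition "L = lin_comb Y (i (1, 0)) (i (0, 1)) f1 f2"

lemma module_Y: "module kt Y" and i: "i \<in> mod_hom kt M Y" and q: "q \<in> mod_hom kt Y M"
  and inj_i: "inj_on i (carrier M)" and im_i: "i ` carrier M = {x \<in> carrier Y. q x = \<zero>\<^bsub>M\<^esub>}"
  using ext by (auto simp: extensions_def)

lemma gens: "{i (1, 0), i (0, 1), f1, f2} \<subseteq> carrier Y"
  using f i generators_in_M by (auto simp: mod_hom_def simp del: M_simps)

lemmas L_closed [simp] = lin_comb_closed[OF module_Y gens, folded L_def]
  and L_add = lin_comb_add[OF module_Y gens, folded L_def]
  and L_smult = lin_comb_smult[OF module_Y gens, folded L_def]
  and L_zero = lin_comb_zero[OF module_Y gens, folded L_def]

lemma L_gens: "L 1 0 0 0 = i (1, 0)" "L 0 1 0 0 = i (0, 1)" "L 0 0 1 0 = f1" "L 0 0 0 1 = f2"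
proof -
  interpret Y: module kt Y by (rule module_Y)
  have "1 \<odot>\<^bsub>Y\<^esub> a = a" "0 \<odot>\<^bsub>Y\<^esub> a = \<zero>\<^bsub>Y\<^esub>" if "a \<in> carrier Y" for a
    using Y.smult_one[of a] Y.smult_l_null[of a] that by auto
  then show "L 1 0 0 0 = i (1, 0)" "L 0 1 0 0 = i (0, 1)" "L 0 0 1 0 = f1" "L 0 0 0 1 = f2"
    using gens by (auto simp: L_def lin_comb_def)
qed

lemma smult_gens:
  "t \<odot>\<^bsub>Y\<^esub> i (1, 0) = L t 0 0 0" "t \<odot>\<^bsub>Y\<^esub> i (0, 1) = L 0 t 0 0"
  "t \<odot>\<^bsub>Y\<^esub> f1 = L 0 0 t 0" "t \<odot>\<^bsub>Y\<^esub> f2 = L 0 0 0 t"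
  using L_smult[of t 1 0 0 0] L_smult[of t 0 1 0 0] L_smult[of t 0 0 1 0] L_smult[of t 0 0 0 1]
  by (simp_all add: L_gens)

lemma i_L: "i (u mod P, v mod p) = L u v 0 0"
  by (simp add: mod_hom_on_M[OF i] smult_gens L_add)

lemma q_L: "q (L u v r s) = (r mod P, s mod p)"
proof -
  have "(u mod P, v mod p) \<in> carrier M" by simp
  then have "q (L u v 0 0) = (0, 0)" unfolding i_L[symmetric] using im_i by auto
  moreover have "q (L 0 0 r 0) = (r mod P, 0)" "q (L 0 0 0 s) = (0, s mod p)"
    using f mod_hom_smult[OF q, of r f1] mod_hom_smult[OF q, of s f2] by (simp_all add: smult_gens)
  moreover have "L u v r s = L u v 0 0 \<oplus>\<^bsub>Y\<^esub> (L 0 0 r 0 \<oplus>\<^bsub>Y\<^esub> L 0 0 0 s)" by (simp add: L_add)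
  moreover have "L 0 0 r 0 \<oplus>\<^bsub>Y\<^esub> L 0 0 0 s \<in> carrier Y" by (simp add: L_add)
  ultimately show ?thesis by (simp add: mod_hom_add[OF q])
qed

lemma relations: "L u v (r + P * r') (s + p * s') = L (u + x * r' + y * s') (v + z * r' + w * s') r s"
proof -
  have "L 0 0 P 0 = L x z 0 0" "L 0 0 0 p = L y w 0 0"
    using f1 f2 by (simp_all add: smult_gens L_add)
  then have "L 0 0 (r' * P) 0 = L (r' * x) (r' * z) 0 0" "L 0 0 0 (s' * p) = L (s' * y) (s' * w) 0 0"
    using L_smult[of r' 0 0 P 0] L_smult[of r' x z 0 0] L_smult[of s' 0 0 0 p] L_smult[of s' y w 0 0]
    by simp_all
  then have "L u v r s \<oplus>\<^bsub>Y\<^esub> (L 0 0 (r' * P) 0 \<oplus>\<^bsub>Y\<^esub> L 0 0 0 (s' * p))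
    = L u v r s \<oplus>\<^bsub>Y\<^esub> (L (r' * x) (r' * z) 0 0 \<oplus>\<^bsub>Y\<^esub> L (s' * y) (s' * w) 0 0)" by simp
  then show ?thesis by (simp add: L_add algebra_simps)
qed

lemma lift_L:
  assumes "a \<in> carrier Y" "q a = (r mod P, s mod p)"
  obtains u v where "a = L u v r s"
proof -
  interpret Y: module kt Y by (rule module_Y)
  let ?b = "L 0 0 (- r) (- s)"
  have "q (a \<oplus>\<^bsub>Y\<^esub> ?b) = (0, 0)"
    using assms by (simp add: mod_hom_add[OF q] q_L mod_simps)
  then have "a \<oplus>\<^bsub>Y\<^esub> ?b \<in> i ` carrier M" using im_i assms by simp
  then obtain u v where "u mod P = u" "v mod p = v" "a \<oplus>\<^bsub>Y\<^esub> ?b = i (u, v)" by auto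
  then have "a \<oplus>\<^bsub>Y\<^esub> ?b = L u v 0 0" using i_L[of u v] by simp
  then have "(a \<oplus>\<^bsub>Y\<^esub> ?b) \<oplus>\<^bsub>Y\<^esub> L 0 0 r s = L u v r s" by (simp add: L_add)
  then have "a = L u v r s" using assms(1) by (simp add: Y.a_assoc L_add L_zero)
  then show ?thesis by (rule that)
qed

lemma L_surj:
  assumes "a \<in> carrier Y"
  obtains u v r s where "a = L u v r s"
proof -
  obtain r s where "q a = (r, s)" "r mod P = r" "s mod p = s"
    using mod_hom_closed[OF q assms] by auto
  then show ?thesis using lift_L[OF assms, of r s] that by metis
qed

text \<open>The presentation of \<open>Y\<close>. A relation maps to \<open>0\<close> under \<open>q\<close>, so
  \<open>P\<close> divides \<open>r\<close> and \<open>p\<close> divides \<open>s\<close>; the defining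
  equations of the matrix then move the combination into the image of \<open>i\<close>, where injectivity
  of \<open>i\<close> decides it.\<close>

lemma L_eq_zero_iff:
  "L u v r s = \<zero>\<^bsub>Y\<^esub> \<longleftrightarrow> (\<exists>r' s'. r = P * r' \<and> s = p * s' \<and>
     P dvd u + x * r' + y * s' \<and> p dvd v + z * r' + w * s')"
proof -
  have *: "L u v 0 0 = \<zero>\<^bsub>Y\<^esub> \<longleftrightarrow> P dvd u \<and> p dvd v" for u v
  proof -
    have "L u v 0 0 = \<zero>\<^bsub>Y\<^esub> \<longleftrightarrow> i (u mod P, v mod p) = i (0 mod P, 0 mod p)"
      unfolding i_L by (simp add: L_zero)
    also have "\<dots> \<longleftrightarrow> P dvd u \<and> p dvd v"
      by (subst inj_on_eq_iff[OF inj_i]) (auto simp: dvd_eq_mod_eq_0)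
    finally show ?thesis .
  qed
  show ?thesis
  proof
    assume 0: "L u v r s = \<zero>\<^bsub>Y\<^esub>"
    then have "q (L u v r s) = q (L 0 0 0 0)" by (simp add: L_zero)
    then obtain r' s' where "r = P * r'" "s = p * s'"
      by (auto simp: q_L dvd_eq_mod_eq_0[symmetric] simp del: power_Suc elim!: dvdE)
    with 0 relations[of u v 0 r' 0 s'] * show "\<exists>r' s'. r = P * r' \<and> s = p * s' \<and>
      P dvd u + x * r' + y * s' \<and> p dvd v + z * r' + w * s'" by auto
  next
    assume "\<exists>r' s'. r = P * r' \<and> s = p * s' \<and>
      P dvd u + x * r' + y * s' \<and> p dvd v + z * r' + w * s'"
    with relations[of u v 0 _ 0] * show "L u v r s = \<zero>\<^bsub>Y\<^esub>" by auto
  qed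
qed

lemma L_eq_iff: "L u v r s = L u' v' r' s' \<longleftrightarrow> L (u - u') (v - v') (r - r') (s - s') = \<zero>\<^bsub>Y\<^esub>"
proof -
  interpret Y: module kt Y by (rule module_Y)
  have "L u v r s = L (u - u') (v - v') (r - r') (s - s') \<oplus>\<^bsub>Y\<^esub> L u' v' r' s'"
    by (simp add: L_add)
  then show ?thesis by (metis L_closed Y.add.r_cancel_one)
qed

end

section \<open>Morphisms between extensions and their matrices\<close>

context hook_module
begin

text \<open>The endomorphism with matrix \<open>(a, p^m b; c, d)\<close>. The factor \<open>p^m\<close> is forced,
  since \<open>p\<close> kills \<open>(0, 1)\<close>.\<close>

definition endo :: "'k poly \<Rightarrow> 'k poly \<Rightarrow> 'k poly \<Rightarrow> 'k poly \<Rightarrow> 'k poly \<times> 'k poly \<Rightarrow> 'k poly \<times> 'k poly"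
  where "endo a b c d =
    (\<lambda>(u, v)\<in>carrier M. ((a * u + p ^ m * b * v) mod P, (c * u + d * v) mod p))"

text \<open>The equation $g E = E' g^\#$, with $g = (a, p^m b; c, d)$ and $g^\# = (a, b; p^m c, d)$. The
  entries other than the first are read modulo \<open>p\<close>, where \<open>p^m\<close> vanishes;
  that is why some products are absent.\<close>

definition intertwines where
  "intertwines a b c d x y z w x' y' z' w' \<longleftrightarrow>
    P dvd (a * x + p ^ m * b * z) - (x' * a + p ^ m * c * y') \<and>
    p dvd a * y - (x' * b + y' * d) \<and>
    p dvd (c * x + d * z) - z' * a \<and>
    p dvd (c * y + d * w) - (z' * b + w' * d)"

text \<open>Arbitrary representatives may be used for the coordinates: \<open>v\<close> matters only modulo
  \<open>p\<close>, so \<open>p^m v\<close> is determined modulo \<open>P\<close>.\<close>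

lemma endo_mod:
  "endo a b c d (u mod P, v mod p) = ((a * u + p ^ m * b * v) mod P, (c * u + d * v) mod p)"
proof -
  have "P dvd p ^ m * (b * (v mod p - v))"
    unfolding P_dvd_power_mult_iff by (intro dvd_mult) (simp add: mod_eq_dvd_iff[symmetric])
  moreover have "P dvd a * (u mod P - u)"
    by (intro dvd_mult) (simp add: mod_eq_dvd_iff[symmetric])
  ultimately have "P dvd a * (u mod P - u) + p ^ m * (b * (v mod p - v))" by (rule dvd_add[rotated])
  also have "\<dots> = (a * (u mod P) + p ^ m * b * (v mod p)) - (a * u + p ^ m * b * v)"
    by (simp add: algebra_simps)
  finally have 1: "(a * (u mod P) + p ^ m * b * (v mod p)) mod P = (a * u + p ^ m * b * v) mod P"
    by (simp add: mod_eq_dvd_iff)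
  have "p dvd c * (u mod P - u) + d * (v mod p - v)"
    using P_dvd_imp[of "u mod P - u"]
    by (intro dvd_add dvd_mult) (simp_all add: mod_eq_dvd_iff[symmetric])
  also have "\<dots> = (c * (u mod P) + d * (v mod p)) - (c * u + d * v)" by (simp add: algebra_simps)
  finally have "(c * (u mod P) + d * (v mod p)) mod p = (c * u + d * v) mod p"
    by (simp add: mod_eq_dvd_iff)
  with 1 show ?thesis by (simp add: endo_def)
qed

text \<open>The image of \<open>f1\<close> lifts \<open>g (1, 0)\<close>, so it is \<open>L u1 v1 a c\<close> for
  some \<open>u1\<close>, \<open>v1\<close>. Computing \<open>P \<phi>(f1)\<close> once from there and once
  from the matrix of the source gives the first column of $g E = E' g^\#$; \<open>f2\<close> gives the
  second. The correction terms \<open>P u1\<close>, \<open>P v1\<close> disappear, and \<open>p u2\<close>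
  is the reason why the upper right entry is only determined modulo \<open>p\<close>.\<close>

lemma intertwines_if_morphism:
  assumes "extn_with_matrix p m Y i q f1 f2 x y z w"
    and "extn_with_matrix p m Y' i' q' f1' f2' x' y' z' w'"
    and mor: "extn_mor kt M (endo a b c d) \<phi> (endo a b c d) (Y, i, q) (Y', i', q')"
  shows "intertwines a b c d x y z w x' y' z' w'"
proof -
  interpret E: extn_with_matrix p m Y i q f1 f2 x y z w by (rule assms)
  interpret E': extn_with_matrix p m Y' i' q' f1' f2' x' y' z' w' by (rule assms)
  interpret Y': module kt Y' by (rule E'.module_Y)
  have \<phi>: "\<phi> \<in> mod_hom kt Y Y'" and \<phi>i: "\<And>u. u \<in> carrier M \<Longrightarrow> \<phi> (i u) = i' (endo a b c d u)"
    and q\<phi>: "\<And>x. x \<in> carrier Y \<Longrightarrow> q' (\<phi> x) = endo a b c d (q x)"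
    using mor by auto
  have \<phi>L: "\<phi> (E.L u v 0 0) = E'.L (a * u + p ^ m * b * v) (c * u + d * v) 0 0" for u v
    unfolding E.i_L[symmetric] E'.i_L[symmetric] by (subst \<phi>i) (simp_all add: endo_mod)
  have "q' (\<phi> f1) = (a mod P, c mod p)" "q' (\<phi> f2) = ((p ^ m * b) mod P, d mod p)"
    using E.f endo_mod[of a b c d 1 0] endo_mod[of a b c d 0 1] by (simp_all add: q\<phi> one_mod)
  moreover have "\<phi> f1 \<in> carrier Y'" "\<phi> f2 \<in> carrier Y'"
    using mod_hom_closed[OF \<phi>] E.f by auto
  ultimately obtain u1 v1 u2 v2
    where F1: "\<phi> f1 = E'.L u1 v1 a c" and F2: "\<phi> f2 = E'.L u2 v2 (p ^ m * b) d"
    by (metis E'.lift_L)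
  have "P \<odot>\<^bsub>Y'\<^esub> \<phi> f1 = \<phi> (E.L x z 0 0)"
    using mod_hom_smult[OF \<phi>, of P f1] E.f E.f1 by (simp add: E.smult_gens E.L_add)
  then have "E'.L (P * u1) (P * v1) (P * a) (P * c)
      = E'.L (a * x + p ^ m * b * z) (c * x + d * z) 0 0"
    by (simp add: F1 E'.L_smult \<phi>L)
  then obtain r s where rs: "P * a = P * r" "P * c = p * s"
    "P dvd P * u1 - (a * x + p ^ m * b * z) + x' * r + y' * s"
    "p dvd P * v1 - (c * x + d * z) + z' * r + w' * s"
    unfolding E'.L_eq_iff E'.L_eq_zero_iff by auto
  then have r: "r = a" and s: "s = p ^ m * c" using p_nonzero by (auto simp: P_def)
  have "P dvd P * u1 - (P * u1 - (a * x + p ^ m * b * z) + x' * r + y' * s)"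
    using rs(3) by (rule dvd_diff[OF dvd_triv_left])
  then have 1: "P dvd (a * x + p ^ m * b * z) - (x' * a + p ^ m * c * y')"
    by (simp add: r s algebra_simps)
  have "p dvd (P * v1 + w' * s) - (P * v1 - (c * x + d * z) + z' * r + w' * s)"
    using p_dvd_P p_dvd_power by (intro dvd_diff[OF dvd_add rs(4)]) (simp_all add: s)
  then have 3: "p dvd (c * x + d * z) - z' * a"
    by (simp add: r algebra_simps)
  have "p \<odot>\<^bsub>Y'\<^esub> \<phi> f2 = \<phi> (E.L y w 0 0)"
    using mod_hom_smult[OF \<phi>, of p f2] E.f E.f2 by (simp add: E.smult_gens E.L_add)
  then have "E'.L (p * u2) (p * v2) (p * (p ^ m * b)) (p * d)
      = E'.L (a * y + p ^ m * b * w) (c * y + d * w) 0 0"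
    by (simp add: F2 E'.L_smult \<phi>L)
  then obtain r s where rs: "p * (p ^ m * b) = P * r" "p * d = p * s"
    "P dvd p * u2 - (a * y + p ^ m * b * w) + x' * r + y' * s"
    "p dvd p * v2 - (c * y + d * w) + z' * r + w' * s"
    unfolding E'.L_eq_iff E'.L_eq_zero_iff by auto
  then have r: "r = b" and s: "s = d" using p_nonzero by (auto simp: P_def)
  have "p dvd (p * u2 - p ^ m * b * w) - (p * u2 - (a * y + p ^ m * b * w) + x' * r + y' * s)"
    using p_dvd_power by (intro dvd_diff[OF _ P_dvd_imp[OF rs(3)]] dvd_diff) simp_all
  then have 2: "p dvd a * y - (x' * b + y' * d)"
    by (simp add: r s algebra_simps)
  have "p dvd p * v2 - (p * v2 - (c * y + d * w) + z' * r + w' * s)"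
    using rs(4) by (rule dvd_diff[OF dvd_triv_left])
  then have "p dvd (c * y + d * w) - (z' * b + w' * d)"
    by (simp add: r s algebra_simps)
  with 1 2 3 show ?thesis by (simp add: intertwines_def)
qed

text \<open>Send the generators of \<open>Y\<close> to the prescribed elements of \<open>Y'\<close>, correcting the
  image of \<open>f2\<close> by a multiple \<open>e\<close> of \<open>i' (1, 0)\<close>. The congruences say
  exactly that the relations of \<open>Y\<close> are respected, so the map is well defined.\<close>

lemma morphism_if_intertwines:
  assumes "extn_with_matrix p m Y i q f1 f2 x y z w"
    and "extn_with_matrix p m Y' i' q' f1' f2' x' y' z' w'"
    and int: "intertwines a b c d x y z w x' y' z' w'"
  shows "\<exists>\<phi>. extn_mor kt M (endo a b c d) \<phi> (endo a b c d) (Y, i, q) (Y', i', q')"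
proof -
  interpret E: extn_with_matrix p m Y i q f1 f2 x y z w by (rule assms)
  interpret E': extn_with_matrix p m Y' i' q' f1' f2' x' y' z' w' by (rule assms)
  interpret Y': module kt Y' by (rule E'.module_Y)
  from int have 1: "P dvd (a * x + p ^ m * b * z) - (x' * a + p ^ m * c * y')"
    and 2: "p dvd a * y - (x' * b + y' * d)"
    and 3: "p dvd (c * x + d * z) - z' * a"
    and 4: "p dvd (c * y + d * w) - (z' * b + w' * d)"
    by (auto simp: intertwines_def)
  \<comment> \<open>the upper right entries agree only modulo p; e measures the difference\<close>
  have "p dvd a * y - (x' * b + y' * d) + p ^ m * b * w"
    using 2 p_dvd_power by (auto intro!: dvd_add)
  then obtain e where "a * y - (x' * b + y' * d) + p ^ m * b * w = p * e" by (rule dvdE)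
  then have e: "p * e = (a * y + p ^ m * b * w) - (x' * b + y' * d)" by (simp add: algebra_simps)
  define \<Phi> where "\<Phi> u v r s = E'.L (a * u + p ^ m * b * v + e * s) (c * u + d * v)
    (a * r + p ^ m * b * s) (c * r + d * s)" for u v r s
  have \<Phi>_add: "\<Phi> u v r s \<oplus>\<^bsub>Y'\<^esub> \<Phi> u1 v1 r1 s1 = \<Phi> (u + u1) (v + v1) (r + r1) (s + s1)"
    for u v r s u1 v1 r1 s1 by (simp add: \<Phi>_def E'.L_add algebra_simps)
  have \<Phi>_smult: "t \<odot>\<^bsub>Y'\<^esub> \<Phi> u v r s = \<Phi> (t * u) (t * v) (t * r) (t * s)" for t u v r s
    by (simp add: \<Phi>_def E'.L_smult algebra_simps)
  have \<Phi>_zero: "\<Phi> u v r s = \<zero>\<^bsub>Y'\<^esub>" if "E.L u v r s = \<zero>\<^bsub>Y\<^esub>" for u v r s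
  proof -
    from that obtain r' s' where rs: "r = P * r'" "s = p * s'"
      and K: "P dvd u + x * r' + y * s'" "p dvd v + z * r' + w * s'"
      unfolding E.L_eq_zero_iff by auto
    \<comment> \<open>g applied to the relation, minus r' times the first column of the hypothesis\<close>
    have "P dvd a * (u + x * r' + y * s') + p ^ m * (b * (v + z * r' + w * s'))
        - r' * ((a * x + p ^ m * b * z) - (x' * a + p ^ m * c * y'))"
      using 1 K by (intro dvd_diff dvd_add) (simp_all add: P_dvd_power_mult_iff)
    also have "\<dots> = (a * u + p ^ m * b * v + p * e * s')
        + x' * (a * r' + b * s') + y' * (p ^ m * c * r' + d * s')"
      unfolding e by (simp add: algebra_simps)
    finally have A: "P dvd (a * u + p ^ m * b * v + e * s)
        + x' * (a * r' + b * s') + y' * (p ^ m * c * r' + d * s')"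
      by (simp add: rs mult_ac)
    have "p dvd c * (u + x * r' + y * s') + d * (v + z * r' + w * s')
        - r' * ((c * x + d * z) - z' * a) - s' * ((c * y + d * w) - (z' * b + w' * d))
        + w' * (p ^ m * c * r')"
      using 3 4 K P_dvd_imp p_dvd_power by (intro dvd_diff dvd_add) simp_all
    also have "\<dots> = (c * u + d * v) + z' * (a * r' + b * s') + w' * (p ^ m * c * r' + d * s')"
      by (simp add: algebra_simps)
    finally have B: "p dvd (c * u + d * v) + z' * (a * r' + b * s') + w' * (p ^ m * c * r' + d * s')" .
    show ?thesis unfolding \<Phi>_def E'.L_eq_zero_iff
      using A B by (intro exI[of _ "a * r' + b * s'"] exI[of _ "p ^ m * c * r' + d * s'"])
        (simp add: rs P_def algebra_simps)
  qed
  have \<Phi>_cong: "\<Phi> u v r s = \<Phi> u1 v1 r1 s1" if "E.L u v r s = E.L u1 v1 r1 s1" for u v r s u1 v1 r1 s1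
  proof -
    have "\<Phi> (u - u1) (v - v1) (r - r1) (s - s1) = \<zero>\<^bsub>Y'\<^esub>"
      using that unfolding E.L_eq_iff by (rule \<Phi>_zero)
    then have "\<zero>\<^bsub>Y'\<^esub> \<oplus>\<^bsub>Y'\<^esub> \<Phi> u1 v1 r1 s1 = \<Phi> u v r s"
      using \<Phi>_add[of "u - u1" "v - v1" "r - r1" "s - s1" u1 v1 r1 s1] by simp
    then show ?thesis by (simp add: \<Phi>_def)
  qed
  \<comment> \<open>any expression of t in the generators may be used, by the previous step\<close>
  define \<phi> where "\<phi> t = (SOME t'. \<exists>u v r s. t = E.L u v r s \<and> t' = \<Phi> u v r s)" for t
  have \<phi>: "\<phi> (E.L u v r s) = \<Phi> u v r s" for u v r s
    unfolding \<phi>_def by (rule some_equality) (blast, metis \<Phi>_cong)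
  have "\<phi> \<in> mod_hom kt Y Y'"
    unfolding mod_hom_def
  proof (intro CollectI conjI ballI)
    show "\<phi> \<in> carrier Y \<rightarrow> carrier Y'"
    proof
      fix t assume "t \<in> carrier Y"
      then show "\<phi> t \<in> carrier Y'" by (elim E.L_surj) (simp add: \<phi>, simp add: \<Phi>_def)
    qed
    fix t assume "t \<in> carrier Y"
    then obtain u v r s where t: "t = E.L u v r s" by (rule E.L_surj)
    show "\<phi> (k \<odot>\<^bsub>Y\<^esub> t) = k \<odot>\<^bsub>Y'\<^esub> \<phi> t" for k
      by (simp add: t \<phi> E.L_smult \<Phi>_smult)
    fix t' assume "t' \<in> carrier Y"
    then obtain u v r s where t': "t' = E.L u v r s" by (rule E.L_surj)
    show "\<phi> (t \<oplus>\<^bsub>Y\<^esub> t') = \<phi> t \<oplus>\<^bsub>Y'\<^esub> \<phi> t'"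
      by (simp add: t t' \<phi> E.L_add \<Phi>_add)
  qed
  moreover have "\<phi> (i t) = i' (endo a b c d t)" if "t \<in> carrier M" for t
  proof -
    have "t = (fst t mod P, snd t mod p)" using that by auto
    then obtain u v where t: "t = (u mod P, v mod p)" by blast
    show ?thesis unfolding t endo_mod E.i_L E'.i_L \<phi> \<Phi>_def by simp
  qed
  moreover have "q' (\<phi> t) = endo a b c d (q t)" if "t \<in> carrier Y" for t
    using that
  proof (rule E.L_surj)
    fix u v r s assume t: "t = E.L u v r s"
    show ?thesis unfolding t \<phi> \<Phi>_def E.q_L E'.q_L endo_mod ..
  qed
  ultimately show ?thesis by auto
qed

section \<open>Classes of extensions correspond to matrices\<close>

lemma M_mod: "t \<in> carrier M \<Longrightarrow> t = (fst t mod P, snd t mod p)"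
  by auto

lemma smult_mod: "k \<odot>\<^bsub>M\<^esub> (u mod P, v mod p) = ((k * u) mod P, (k * v) mod p)"
  by (simp add: mod_mult_right_eq)

lemma add_mod: "(u mod P, v mod p) \<oplus>\<^bsub>M\<^esub> (u' mod P, v' mod p) = ((u + u') mod P, (v + v') mod p)"
  by (simp add: mod_add_eq)

lemma ext_of_matrix_iff:
  "(Y, i, q) \<in> ext_of_matrix p m (Mat2 x y z w) \<longleftrightarrow> (\<exists>f1 f2. extn_with_matrix p m Y i q f1 f2 x y z w)"
  unfolding ext_of_matrix_def extn_with_matrix_def extn_with_matrix_axioms_def mem_Collect_eq
    ext_has_matrix.simps P_def
  using hook_module_axioms by blast

lemma extn_has_some_matrix:
  assumes ext: "(Y, i, q) \<in> extensions kt M M"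
  shows "\<exists>f1 f2 x y z w. extn_with_matrix p m Y i q f1 f2 x y z w"
proof -
  note E = extensionsD[OF ext]
  have "(1, 0) \<in> q ` carrier Y" "(0, 1) \<in> q ` carrier Y"
    unfolding E(5) by (fact generators_in_M)+
  then obtain f1 f2 where f: "f1 \<in> carrier Y" "f2 \<in> carrier Y" "q f1 = (1, 0)" "q f2 = (0, 1)"
    by (metis imageE)
  interpret Y: module kt Y by (rule E)
  have comb: "\<exists>u v. t = u \<odot>\<^bsub>Y\<^esub> i (1, 0) \<oplus>\<^bsub>Y\<^esub> v \<odot>\<^bsub>Y\<^esub> i (0, 1)"
    if t: "t \<in> carrier Y" "q t = (0, 0)" for t
  proof -
    have "t \<in> i ` carrier M" using t E(6) by simp
    then obtain s where s: "t = i s" "s \<in> carrier M" by (rule imageE)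
    have "i s = fst s \<odot>\<^bsub>Y\<^esub> i (1, 0) \<oplus>\<^bsub>Y\<^esub> snd s \<odot>\<^bsub>Y\<^esub> i (0, 1)"
      by (subst M_mod[OF s(2)]) (rule mod_hom_on_M[OF E(2)])
    then show ?thesis unfolding s(1) by blast
  qed
  have "P \<odot>\<^bsub>Y\<^esub> f1 \<in> carrier Y" "q (P \<odot>\<^bsub>Y\<^esub> f1) = (0, 0)"
      "p \<odot>\<^bsub>Y\<^esub> f2 \<in> carrier Y" "q (p \<odot>\<^bsub>Y\<^esub> f2) = (0, 0)"
    using mod_hom_smult[OF E(3), of P f1] mod_hom_smult[OF E(3), of p f2] f
      Y.smult_closed[of P f1] Y.smult_closed[of p f2] by simp_all
  then obtain x z y w where "P \<odot>\<^bsub>Y\<^esub> f1 = x \<odot>\<^bsub>Y\<^esub> i (1, 0) \<oplus>\<^bsub>Y\<^esub> z \<odot>\<^bsub>Y\<^esub> i (0, 1)"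
    "p \<odot>\<^bsub>Y\<^esub> f2 = y \<odot>\<^bsub>Y\<^esub> i (1, 0) \<oplus>\<^bsub>Y\<^esub> w \<odot>\<^bsub>Y\<^esub> i (0, 1)"
    using comb by metis
  then have "extn_with_matrix p m Y i q f1 f2 x y z w"
    using ext f by unfold_locales
  then show ?thesis by blast
qed

text \<open>Every matrix is realised, by the module with the generators and relations of the presentation.
  The normal form reduces the coefficients of \<open>f1\<close> and \<open>f2\<close> modulo
  \<open>P\<close> and \<open>p\<close>; each quotient by which they are reduced is carried over to the
  submodule as a multiple of the corresponding column of the matrix.\<close>

lemma ext_of_matrix_nonempty:
  "ext_of_matrix p m (Mat2 x y z w) \<noteq> {}"
proof -
  define N :: "('k poly \<times> 'k poly) \<times> 'k poly \<times> 'k poly \<Rightarrow> ('k poly \<times> 'k poly) \<times> 'k poly \<times> 'k poly"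
    where "N = (\<lambda>((u, v), (r, s)).
      (((u + x * (r div P) + y * (s div p)) mod P, (v + z * (r div P) + w * (s div p)) mod p),
       (r mod P, s mod p)))"
  define sm :: "'k poly \<Rightarrow> ('k poly \<times> 'k poly) \<times> 'k poly \<times> 'k poly \<Rightarrow> ('k poly \<times> 'k poly) \<times> 'k poly \<times> 'k poly"
    where "sm = (\<lambda>t ((u, v), (r, s)). ((t * u, t * v), (t * r, t * s)))"
  define Y where "Y = \<lparr>carrier = range N, monoid.mult = (\<lambda>a b. N (a + b)), monoid.one = N 0, ring.zero = N 0,
    ring.add = (\<lambda>a b. N (a + b)), module.smult = (\<lambda>r a. N (sm r a))\<rparr>"
  define i :: "'k poly \<times> 'k poly \<Rightarrow> ('k poly \<times> 'k poly) \<times> 'k poly \<times> 'k poly"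
    where "i a = (a, (0, 0))" for a
  have N0: "N 0 = 0" by (simp add: N_def zero_prod_def)
  have N_add: "N (N a + b) = N (a + b)" for a b
  proof -
    obtain u v r s u' v' r' s' where ab: "a = ((u, v), (r, s))" "b = ((u', v'), (r', s'))"
      by (metis surj_pair)
    show ?thesis
      by (simp add: N_def ab div_carry(1)[of r r'] div_carry(1)[of s s'] add.assoc mod_add_left_eq)
         (simp add: algebra_simps)
  qed
  have N_sm: "N (sm t (N a)) = N (sm t a)" for t a
  proof -
    obtain u v r s where a: "a = ((u, v), (r, s))" by (metis surj_pair)
    have 1: "(t * (k mod n) + l) mod n = (t * k + l) mod n" for k l n :: "'k poly"
      by (metis mod_add_left_eq mod_mult_right_eq)
    show ?thesis
      by (simp add: N_def sm_def a div_carry(2)[of t r] div_carry(2)[of t s] mod_simps add.assoc 1)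
         (simp add: algebra_simps)
  qed
  have Y: "module kt Y"
    by (rule module_of_normal_form[where N = N and sm = sm])
       (auto simp: Y_def N_add N_sm, auto simp: sm_def algebra_simps split: prod.splits)
  have carrier_Y: "a \<in> carrier Y \<longleftrightarrow> fst a \<in> carrier M \<and> snd a \<in> carrier M" for a
  proof
    assume "a \<in> carrier Y"
    then show "fst a \<in> carrier M \<and> snd a \<in> carrier M" by (auto simp: Y_def N_def)
  next
    assume a: "fst a \<in> carrier M \<and> snd a \<in> carrier M"
    have "r div P = 0" if "r mod P = r" for r
      using that p_nonzero by (metis P_def add_diff_cancel_right' div_mult_mod_eq mult_eq_0_iff
          power_not_zero diff_self)
    moreover have "s div p = 0" if "s mod p = s" for s
      using that p_nonzero by (metis add_diff_cancel_right' div_mult_mod_eq mult_eq_0_iff diff_self)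
    ultimately have "N a = a" using a by (auto simp: N_def split: prod.splits)
    then show "a \<in> carrier Y" unfolding Y_def by (metis partial_object.select_convs(1) rangeI)
  qed
  have "(Y, i, snd) \<in> extensions kt M M"
    unfolding extensions_def mem_Collect_eq prod.case
  proof (intro conjI)
    show "module kt Y" by (rule Y)
    show "i \<in> mod_hom kt M Y"
      unfolding mod_hom_def by (auto simp: carrier_Y i_def) (auto simp: Y_def N_def sm_def)
    show "snd \<in> mod_hom kt Y M"
      unfolding mod_hom_def by (auto simp: carrier_Y) (auto simp: Y_def N_def sm_def)
    show "inj_on i (carrier M)" by (auto simp: inj_on_def i_def)
    show "snd ` carrier Y = carrier M"
    proof (intro equalityI subsetI)
      fix t assume "t \<in> carrier M"
      then have "((0, 0), t) \<in> carrier Y" by (simp add: carrier_Y)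
      then show "t \<in> snd ` carrier Y" by (metis image_eqI snd_conv)
    qed (auto simp: carrier_Y)
    show "i ` carrier M = {x \<in> carrier Y. snd x = \<zero>\<^bsub>M\<^esub>}"
      by (auto simp: carrier_Y i_def)
  qed
  moreover have "ext_has_matrix p m (Y, i, snd) (Mat2 x y z w)"
    unfolding ext_has_matrix.simps P_def[symmetric]
    using p_nonzero
    by (intro bexI[of _ "((0, 0), (1, 0))"] bexI[of _ "((0, 0), (0, 1))"] conjI)
       (simp_all add: carrier_Y one_mod, simp_all add: Y_def N_def sm_def i_def P_def del: power_Suc)
  ultimately have "(Y, i, snd) \<in> ext_of_matrix p m (Mat2 x y z w)"
    by (simp add: ext_of_matrix_def del: ext_has_matrix.simps)
  then show ?thesis by blast
qed

lemma endo_identity: "t \<in> carrier M \<Longrightarrow> endo 1 0 0 1 t = t"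
  using endo_mod[of 1 0 0 1 "fst t" "snd t"] by auto

lemma ext_of_matrix_subset: "ext_of_matrix p m E \<subseteq> extensions kt M M"
  by (auto simp: ext_of_matrix_def)

text \<open>A morphism that is the identity on both ends transports the lifts. In the other direction, the
  identity matrix intertwines a matrix with itself.\<close>

lemma equivalent_iff_same_matrix:
  assumes \<xi>: "\<xi> \<in> ext_of_matrix p m (Mat2 x y z w)" and \<xi>': "\<xi>' \<in> extensions kt M M"
  shows "(\<exists>\<phi>. extn_mor kt M id \<phi> id \<xi> \<xi>') \<longleftrightarrow> \<xi>' \<in> ext_of_matrix p m (Mat2 x y z w)"
proof -
  obtain Y i q Y' i' q' where \<xi>_eq: "\<xi> = (Y, i, q)" "\<xi>' = (Y', i', q')" by (metis prod_cases3)
  obtain f1 f2 where "extn_with_matrix p m Y i q f1 f2 x y z w"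
    using \<xi> ext_of_matrix_iff \<xi>_eq by blast
  then interpret E: extn_with_matrix p m Y i q f1 f2 x y z w .
  show ?thesis
  proof
    assume "\<exists>\<phi>. extn_mor kt M id \<phi> id \<xi> \<xi>'"
    then obtain \<phi> where \<phi>: "\<phi> \<in> mod_hom kt Y Y'" and \<phi>i: "\<And>u. u \<in> carrier M \<Longrightarrow> \<phi> (i u) = i' u"
      and q\<phi>: "\<And>x. x \<in> carrier Y \<Longrightarrow> q' (\<phi> x) = q x"
      by (auto simp: \<xi>_eq)
    interpret Y: module kt Y by (rule E.module_Y)
    have \<phi>_comb: "\<phi> (u \<odot>\<^bsub>Y\<^esub> i (1, 0) \<oplus>\<^bsub>Y\<^esub> v \<odot>\<^bsub>Y\<^esub> i (0, 1)) = u \<odot>\<^bsub>Y'\<^esub> i' (1, 0) \<oplus>\<^bsub>Y'\<^esub> v \<odot>\<^bsub>Y'\<^esub> i' (0, 1)" for u v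
      using E.gens Y.smult_closed[of u] Y.smult_closed[of v]
      by (simp add: mod_hom_add[OF \<phi>] mod_hom_smult[OF \<phi>] \<phi>i[OF generators_in_M(1)] \<phi>i[OF generators_in_M(2)]
          del: M_simps)
    have "extn_with_matrix p m Y' i' q' (\<phi> f1) (\<phi> f2) x y z w"
    proof
      show "(Y', i', q') \<in> extensions kt M M" using \<xi>' \<xi>_eq by simp
      show "\<phi> f1 \<in> carrier Y'" "\<phi> f2 \<in> carrier Y'" "q' (\<phi> f1) = (1, 0)" "q' (\<phi> f2) = (0, 1)"
        using E.f mod_hom_closed[OF \<phi>] by (simp_all add: q\<phi>)
      show "P \<odot>\<^bsub>Y'\<^esub> \<phi> f1 = x \<odot>\<^bsub>Y'\<^esub> i' (1, 0) \<oplus>\<^bsub>Y'\<^esub> z \<odot>\<^bsub>Y'\<^esub> i' (0, 1)"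
        using mod_hom_smult[OF \<phi>, of P f1] E.f E.f1 \<phi>_comb by simp
      show "p \<odot>\<^bsub>Y'\<^esub> \<phi> f2 = y \<odot>\<^bsub>Y'\<^esub> i' (1, 0) \<oplus>\<^bsub>Y'\<^esub> w \<odot>\<^bsub>Y'\<^esub> i' (0, 1)"
        using mod_hom_smult[OF \<phi>, of p f2] E.f E.f2 \<phi>_comb by simp
    qed
    then show "\<xi>' \<in> ext_of_matrix p m (Mat2 x y z w)" using ext_of_matrix_iff \<xi>_eq by blast
  next
    assume "\<xi>' \<in> ext_of_matrix p m (Mat2 x y z w)"
    then obtain f1' f2' where "extn_with_matrix p m Y' i' q' f1' f2' x y z w"
      using ext_of_matrix_iff \<xi>_eq by blast
    moreover have "intertwines 1 0 0 1 x y z w x y z w" by (simp add: intertwines_def)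
    ultimately obtain \<phi> where \<phi>: "extn_mor kt M (endo 1 0 0 1) \<phi> (endo 1 0 0 1) \<xi> \<xi>'"
      unfolding \<xi>_eq by (elim exE[OF morphism_if_intertwines[OF E.extn_with_matrix_axioms], rotated -1])
    have "extn_mor kt M id \<phi> id \<xi> \<xi>'"
      by (rule extn_mor_cong[OF E.ext[folded \<xi>_eq] \<phi>]) (simp_all add: endo_identity del: M_simps)
    then show "\<exists>\<phi>. extn_mor kt M id \<phi> id \<xi> \<xi>'" by blast
  qed
qed

lemma E_lam_iff: "C \<in> E_lam p m \<longleftrightarrow> (\<exists>x y z w. C = ext_of_matrix p m (Mat2 x y z w))"
proof -
  have class_eq: "extn_equiv kt M M `` {\<xi>} = ext_of_matrix p m (Mat2 x y z w)"
    if "\<xi> \<in> ext_of_matrix p m (Mat2 x y z w)" for \<xi> x y z w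
  proof -
    have "\<xi> \<in> extensions kt M M" using that ext_of_matrix_subset by blast
    then have "(\<xi>, \<xi>') \<in> extn_equiv kt M M \<longleftrightarrow> \<xi>' \<in> ext_of_matrix p m (Mat2 x y z w)" for \<xi>'
      using equivalent_iff_same_matrix[OF that] ext_of_matrix_subset
      unfolding extn_equiv_def by blast
    then show ?thesis by blast
  qed
  show ?thesis
  proof
    assume "C \<in> E_lam p m"
    then obtain \<xi> where \<xi>: "\<xi> \<in> extensions kt M M" "C = extn_equiv kt M M `` {\<xi>}"
      by (auto simp: E_lam_def Ext1_def elim!: quotientE)
    obtain Y i q where \<xi>_eq: "\<xi> = (Y, i, q)" by (metis prod_cases3)
    with \<xi> extn_has_some_matrix ext_of_matrix_iff obtain x y z w
      where "\<xi> \<in> ext_of_matrix p m (Mat2 x y z w)" by metis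
    then show "\<exists>x y z w. C = ext_of_matrix p m (Mat2 x y z w)" using class_eq \<xi> by blast
  next
    assume "\<exists>x y z w. C = ext_of_matrix p m (Mat2 x y z w)"
    then obtain x y z w where C: "C = ext_of_matrix p m (Mat2 x y z w)" by blast
    obtain \<xi> where \<xi>: "\<xi> \<in> C" using ext_of_matrix_nonempty C by blast
    then have "\<xi> \<in> extensions kt M M" using C ext_of_matrix_subset by blast
    with class_eq[OF \<xi>[unfolded C]] show "C \<in> E_lam p m"
      unfolding E_lam_def Ext1_def C by (metis quotientI)
  qed
qed

section \<open>Automorphisms and their action on matrices\<close>

text \<open>The image of \<open>(0, 1)\<close> is killed by \<open>p\<close>, so its first coordinate is divisible by
  \<open>p^m\<close>.\<close>

lemma endomorphism_is_endo:
  assumes "g \<in> mod_hom kt M M"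
  shows "\<exists>a b c d. a mod P = a \<and> b mod p = b \<and> c mod p = c \<and> d mod p = d \<and>
    (\<forall>t\<in>carrier M. g t = endo a b c d t)"
proof -
  obtain a c B d where g: "g (1, 0) = (a, c)" "g (0, 1) = (B, d)" by (metis surj_pair)
  have red: "a mod P = a" "c mod p = c" "B mod P = B" "d mod p = d"
    using mod_hom_closed[OF assms generators_in_M(1)] mod_hom_closed[OF assms generators_in_M(2)] g
    by auto
  have "g (p \<odot>\<^bsub>M\<^esub> (0, 1)) = p \<odot>\<^bsub>M\<^esub> (B, d)"
    using mod_hom_smult[OF assms _ generators_in_M(2), of p] g by simp
  moreover have "g (p \<odot>\<^bsub>M\<^esub> (0, 1)) = (0, 0)"
    using mod_hom_zero[OF assms module_M module_M] by simp
  ultimately have "P dvd p * B" by (simp add: dvd_eq_mod_eq_0)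
  then have "p ^ m dvd B" using p_nonzero by (simp add: P_def)
  then obtain b where b: "B = p ^ m * b" by (elim dvdE)
  have "p ^ m * (b mod p) = (p ^ m * b) mod P"
    by (simp only: P_def power_add power_one_right mod_mult_mult1)
  also have "\<dots> = p ^ m * b" using red(3) unfolding b .
  finally have "b mod p = b" using p_nonzero by simp
  moreover have "g t = endo a b c d t" if t_M: "t \<in> carrier M" for t
  proof -
    obtain u v where t: "t = (u mod P, v mod p)" using M_mod[OF t_M] by blast
    have "g t = u \<odot>\<^bsub>M\<^esub> (a mod P, c mod p) \<oplus>\<^bsub>M\<^esub> v \<odot>\<^bsub>M\<^esub> (B mod P, d mod p)"
      unfolding t mod_hom_on_M[OF assms] g red ..
    then show ?thesis unfolding t smult_mod add_mod endo_mod by (simp add: b mult_ac)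
  qed
  ultimately show ?thesis
    by (intro exI[of _ a] exI[of _ b] exI[of _ c] exI[of _ d]) (simp add: red del: M_simps)
qed

lemma endo_in_mod_hom: "endo a b c d \<in> mod_hom kt M M"
  unfolding mod_hom_def
proof (intro CollectI conjI ballI)
  show "endo a b c d \<in> carrier M \<rightarrow> carrier M" by (auto simp: endo_def)
  fix t assume "t \<in> carrier M"
  then obtain u v where t: "t = (u mod P, v mod p)" using M_mod by blast
  show "endo a b c d (k \<odot>\<^bsub>M\<^esub> t) = k \<odot>\<^bsub>M\<^esub> endo a b c d t" for k
  proof -
    have "a * (k * u) + p ^ m * b * (k * v) = k * (a * u + p ^ m * b * v)"
      "c * (k * u) + d * (k * v) = k * (c * u + d * v)" by (simp_all add: algebra_simps)
    then show ?thesis unfolding t smult_mod endo_mod by (simp only:)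
  qed
  fix t' assume "t' \<in> carrier M"
  then obtain u' v' where t': "t' = (u' mod P, v' mod p)" using M_mod by blast
  show "endo a b c d (t \<oplus>\<^bsub>M\<^esub> t') = endo a b c d t \<oplus>\<^bsub>M\<^esub> endo a b c d t'"
  proof -
    have "a * (u + u') + p ^ m * b * (v + v') = (a * u + p ^ m * b * v) + (a * u' + p ^ m * b * v')"
      "c * (u + u') + d * (v + v') = (c * u + d * v) + (c * u' + d * v')" by (simp_all add: algebra_simps)
    then show ?thesis unfolding t t' add_mod endo_mod by (simp only:)
  qed
qed

lemma P_dvd_cancel_unit: "P dvd a * u \<Longrightarrow> \<not> p dvd a \<Longrightarrow> P dvd u"
proof -
  assume au: "P dvd a * u" and "\<not> p dvd a"
  then obtain a' where "P dvd a * a' - 1"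
    using irreducible_power_inverse[OF irr, of a "m + 1"] by (auto simp: P_def)
  then have "P dvd a' * (a * u) - u * (a * a' - 1)" using au by (intro dvd_diff) simp_all
  then show "P dvd u" by (simp add: algebra_simps)
qed

lemma G_lam_carrier: "g \<in> carrier (G_lam p m) \<longleftrightarrow> g \<in> mod_hom kt M M \<and> g \<in> Bij (carrier M)"
  unfolding G_lam_def by (rule mod_AutoGroup_carrier)

text \<open>Surjectivity forces the diagonal entries to be units: modulo \<open>p\<close> the matrix is lower
  triangular, because \<open>m \<ge> 1\<close>.\<close>

lemma automorphism_is_endo:
  assumes "g \<in> carrier (G_lam p m)"
  shows "\<exists>a b c d. a mod P = a \<and> b mod p = b \<and> c mod p = c \<and> d mod p = d \<and>
    \<not> p dvd a \<and> \<not> p dvd d \<and> g = endo a b c d"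
proof -
  have g: "g \<in> mod_hom kt M M" "g \<in> Bij (carrier M)"
    using assms by (simp_all add: G_lam_carrier del: M_simps)
  obtain a b c d where red: "a mod P = a" "b mod p = b" "c mod p = c" "d mod p = d"
    and eq: "\<And>t. t \<in> carrier M \<Longrightarrow> g t = endo a b c d t"
    using endomorphism_is_endo[OF g(1)] by blast
  have "g = endo a b c d"
  proof (rule ext)
    fix t show "g t = endo a b c d t"
    proof (cases "t \<in> carrier M")
      case True
      then show ?thesis by (rule eq)
    next
      case False
      have "endo a b c d \<in> extensional (carrier M)" unfolding endo_def by (rule restrict_extensional)
      then show ?thesis
        using False Bij_imp_extensional[OF g(2)] by (metis extensional_arb)
    qed
  qed
  have surj: "\<exists>u v. endo a b c d (u mod P, v mod p) = s" if s: "s \<in> carrier M" for s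
  proof -
    have "s \<in> g ` carrier M" using g(2) s by (simp add: Bij_def bij_betw_def del: M_simps)
    then obtain t where t: "s = g t" "t \<in> carrier M" by (rule imageE)
    have "endo a b c d (fst t mod P, snd t mod p) = s"
      using eq[OF t(2)] unfolding t(1) M_mod[OF t(2), symmetric] by (rule sym)
    then show ?thesis by blast
  qed
  have "\<not> p dvd a"
  proof
    assume "p dvd a"
    obtain u v where "endo a b c d (u mod P, v mod p) = (1, 0)" using surj generators_in_M by blast
    then have "(a * u + p ^ m * b * v) mod P = 1" by (simp add: endo_mod)
    moreover have "p dvd (a * u + p ^ m * b * v) mod P"
      using \<open>p dvd a\<close> p_dvd_power by (simp add: dvd_mod_iff[OF p_dvd_P])
    ultimately show False using p_not_dvd_one by simp
  qed
  moreover have "\<not> p dvd d"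
  proof
    assume "p dvd d"
    obtain u v where "endo a b c d (u mod P, v mod p) = (0, 1)" using surj generators_in_M by blast
    then have uv: "P dvd a * u + p ^ m * b * v" "(c * u + d * v) mod p = 1"
      by (simp_all add: endo_mod mod_eq_0_iff_dvd)
    have "p dvd a * u + p ^ m * b * v - p ^ m * b * v"
      using P_dvd_imp[OF uv(1)] p_dvd_power by (intro dvd_diff) simp_all
    then have "p dvd u" using \<open>\<not> p dvd a\<close> by (simp add: p_dvd_mult_iff)
    then have "p dvd c * u + d * v" using \<open>p dvd d\<close> by simp
    with uv(2) show False by (simp add: dvd_eq_mod_eq_0)
  qed
  ultimately show ?thesis using red \<open>g = endo a b c d\<close> by (intro exI conjI)
qed

text \<open>The system is triangular modulo \<open>p\<close>: the first equation determines \<open>u\<close> modulo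
  \<open>p\<close>, this determines \<open>v\<close>, and \<open>v\<close> then corrects \<open>u\<close>
  modulo \<open>P\<close>.\<close>

lemma endo_is_automorphism:
  assumes a: "\<not> p dvd a" and d: "\<not> p dvd d"
  shows "endo a b c d \<in> carrier (G_lam p m)"
proof -
  have "inj_on (endo a b c d) (carrier M)"
  proof (rule inj_onI)
    fix s t assume s: "s \<in> carrier M" and t: "t \<in> carrier M" and eq: "endo a b c d s = endo a b c d t"
    obtain u v where s': "s = (u mod P, v mod p)" using M_mod[OF s] by blast
    obtain u' v' where t': "t = (u' mod P, v' mod p)" using M_mod[OF t] by blast
    define U V where "U = u - u'" and "V = v - v'"
    have "P dvd (a * u + p ^ m * b * v) - (a * u' + p ^ m * b * v')"
      and "p dvd (c * u + d * v) - (c * u' + d * v')"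
      using eq by (simp_all add: s' t' endo_mod mod_eq_dvd_iff)
    then have 1: "P dvd a * U + p ^ m * (b * V)" and 2: "p dvd c * U + d * V"
      by (simp_all add: U_def V_def algebra_simps)
    have "p dvd a * U + p ^ m * (b * V) - p ^ m * (b * V)"
      using P_dvd_imp[OF 1] p_dvd_power by (intro dvd_diff) simp_all
    then have U: "p dvd U" using a by (simp add: p_dvd_mult_iff)
    have "p dvd c * U + d * V - c * U" using 2 U by (intro dvd_diff) simp_all
    then have V: "p dvd V" using d by (simp add: p_dvd_mult_iff)
    have "P dvd a * U + p ^ m * (b * V) - p ^ m * (b * V)"
      using 1 V by (intro dvd_diff) (simp_all add: P_dvd_power_mult_iff)
    then have "P dvd a * U" by simp
    then have "P dvd U" using a by (rule P_dvd_cancel_unit)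
    with V show "s = t" by (simp add: s' t' U_def V_def mod_eq_dvd_iff)
  qed
  moreover have "endo a b c d ` carrier M = carrier M"
  proof (intro equalityI subsetI)
    fix t assume t: "t \<in> carrier M"
    obtain s r where t': "t = (s mod P, r mod p)" using M_mod[OF t] by blast
    obtain a' where a': "P dvd a * a' - 1"
      using irreducible_power_inverse[OF irr a, of "m + 1"] by (auto simp: P_def)
    obtain d' where d': "p dvd d * d' - 1" using irreducible_poly_inverse[OF irr d] by blast
    \<comment> \<open>a' s is the solution u modulo p, which is all that the second coordinate sees\<close>
    define v where "v = d' * (r - c * (a' * s))"
    define u where "u = a' * (s - p ^ m * b * v)"
    have "P dvd (a * a' - 1) * (s - p ^ m * b * v)" using a' by simp
    also have "\<dots> = (a * u + p ^ m * b * v) - s" by (simp add: u_def algebra_simps)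
    finally have 1: "(a * u + p ^ m * b * v) mod P = s mod P" by (simp add: mod_eq_dvd_iff)
    have "p dvd (d * d' - 1) * (r - c * (a' * s)) - p ^ m * (c * a' * b * v)"
      using d' p_dvd_power by (intro dvd_diff) simp_all
    also have "\<dots> = (c * u + d * v) - r" by (simp add: u_def v_def algebra_simps)
    finally have "(c * u + d * v) mod p = r mod p" by (simp add: mod_eq_dvd_iff)
    with 1 have "t = endo a b c d (u mod P, v mod p)" by (simp add: t' endo_mod)
    then show "t \<in> endo a b c d ` carrier M" by simp
  next
    fix t assume "t \<in> endo a b c d ` carrier M"
    then show "t \<in> carrier M" using mod_hom_closed[OF endo_in_mod_hom] by blast
  qed
  ultimately have "bij_betw (endo a b c d) (carrier M) (carrier M)" by (simp only: bij_betw_def)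
  moreover have "endo a b c d \<in> extensional (carrier M)" by (simp add: endo_def del: M_simps)
  ultimately show ?thesis
    unfolding G_lam_carrier Bij_def by (auto simp: endo_in_mod_hom simp del: M_simps)
qed

lemma aut_matrix_endo:
  assumes "a mod P = a" "b mod p = b" "c mod p = c" "d mod p = d"
  shows "aut_matrix (endo a b c d) = Mat2 a (p ^ m * b) c d"
proof -
  have "(p ^ m * b) mod P = p ^ m * (b mod p)"
    by (simp only: P_def power_add power_one_right mod_mult_mult1)
  then show ?thesis
    using endo_mod[of a b c d 1 0] endo_mod[of a b c d 0 1] assms
    by (simp add: aut_matrix_def one_mod)
qed

text \<open>Two extensions that receive morphisms over the same \<open>g\<close> from extensions in one class are
  equivalent, by the five lemma; hence the image of a class is again determined by one matrix.\<close>

lemma act_lam_eq_iff: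
  assumes g: "endo a b c d \<in> carrier (G_lam p m)"
  shows "act_lam p m (endo a b c d) (ext_of_matrix p m (Mat2 x y z w)) = ext_of_matrix p m (Mat2 x' y' z' w')
    \<longleftrightarrow> intertwines a b c d x y z w x' y' z' w'" (is "?act = ?E' \<longleftrightarrow> _")
proof -
  let ?g = "endo a b c d" and ?E = "ext_of_matrix p m (Mat2 x y z w)"
  have "?E \<in> E_lam p m" unfolding E_lam_iff by blast
  then have act: "?act = {\<xi>' \<in> extensions kt M M. \<exists>\<xi>\<in>?E. \<exists>\<phi>. extn_mor kt M ?g \<phi> ?g \<xi> \<xi>'}"
    unfolding act_lam_def
    by (intro ext_act_eq module_M g[unfolded G_lam_def]) (simp add: E_lam_def)
  obtain h where gh: "inverse_endos kt M ?g h"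
    using inverse_endos_inv[OF module_M g[unfolded G_lam_def]] by blast
  show ?thesis
  proof
    assume eq: "?act = ?E'"
    obtain Y' i' q' where \<xi>': "(Y', i', q') \<in> ?E'" using ext_of_matrix_nonempty by (metis ex_in_conv prod_cases3)
    then have "(Y', i', q') \<in> ?act" unfolding eq .
    then obtain \<xi> \<phi> where mor: "\<xi> \<in> ?E" "extn_mor kt M ?g \<phi> ?g \<xi> (Y', i', q')"
      unfolding act by blast
    obtain Y i q where \<xi>: "\<xi> = (Y, i, q)" by (metis prod_cases3)
    from mor(1) \<xi>' obtain f1 f2 f1' f2' where "extn_with_matrix p m Y i q f1 f2 x y z w"
      "extn_with_matrix p m Y' i' q' f1' f2' x' y' z' w'"
      unfolding \<xi> ext_of_matrix_iff by blast
    from intertwines_if_morphism[OF this mor(2)[unfolded \<xi>]]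
    show "intertwines a b c d x y z w x' y' z' w'" .
  next
    assume int: "intertwines a b c d x y z w x' y' z' w'"
    have mor: "\<exists>\<phi>. extn_mor kt M ?g \<phi> ?g \<xi> \<xi>'" if "\<xi> \<in> ?E" "\<xi>' \<in> ?E'" for \<xi> \<xi>'
    proof -
      obtain Y i q Y' i' q' where \<xi>: "\<xi> = (Y, i, q)" "\<xi>' = (Y', i', q')" by (metis prod_cases3)
      from that obtain f1 f2 f1' f2' where "extn_with_matrix p m Y i q f1 f2 x y z w"
        "extn_with_matrix p m Y' i' q' f1' f2' x' y' z' w'"
        unfolding \<xi> ext_of_matrix_iff by blast
      from morphism_if_intertwines[OF this int] show ?thesis unfolding \<xi> .
    qed
    show "?act = ?E'"
    proof (intro equalityI subsetI)
      fix \<xi>'' assume "\<xi>'' \<in> ?act"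
      then obtain \<xi> \<phi> where *: "\<xi>'' \<in> extensions kt M M" "\<xi> \<in> ?E" "extn_mor kt M ?g \<phi> ?g \<xi> \<xi>''"
        unfolding act by blast
      obtain \<xi>' where \<xi>': "\<xi>' \<in> ?E'" using ext_of_matrix_nonempty by blast
      obtain \<psi> where "extn_mor kt M ?g \<psi> ?g \<xi> \<xi>'" using mor[OF *(2) \<xi>'] by blast
      moreover have ext: "\<xi> \<in> extensions kt M M" "\<xi>' \<in> extensions kt M M"
        using ext_of_matrix_subset *(2) \<xi>' by blast+
      ultimately obtain \<chi> where \<chi>: "extn_mor kt M h \<chi> h \<xi>' \<xi>"
        using extn_mor_inverse[OF module_M ext _ gh gh] by blast
      have "extn_mor kt M id (\<phi> \<circ> \<chi>) id \<xi>' \<xi>''"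
        by (rule extn_mor_comp[OF ext(2) _ \<chi> *(3)])
          (use gh in \<open>simp_all add: inverse_endos_def del: M_simps\<close>)
      then show "\<xi>'' \<in> ?E'" using equivalent_iff_same_matrix[OF \<xi>' *(1)] by blast
    next
      fix \<xi>' assume \<xi>': "\<xi>' \<in> ?E'"
      obtain \<xi> where "\<xi> \<in> ?E" using ext_of_matrix_nonempty by blast
      with mor[OF _ \<xi>'] \<xi>' show "\<xi>' \<in> ?act" unfolding act using ext_of_matrix_subset by blast
    qed
  qed
qed

lemma Units_P: "a \<in> Units (poly_quot P) \<longleftrightarrow> a mod P = a \<and> \<not> p dvd a"
  unfolding P_def using Units_poly_quot_power[OF irr, of "m + 1"] by simp

lemma Units_p: "a \<in> Units (poly_quot p) \<longleftrightarrow> a mod p = a \<and> \<not> p dvd a"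
  using Units_poly_quot_power[OF irr, of 1] by simp

lemma stabilizer_matrices:
  "aut_matrix ` stabilizer (G_lam p m) (act_lam p m) (ext_of_matrix p m (Mat2 x y z w)) =
    {Mat2 a (p ^ m * b) c d | a b c d. a \<in> Units (poly_quot P) \<and> b mod p = b \<and> c mod p = c \<and>
      d \<in> Units (poly_quot p) \<and> intertwines a b c d x y z w x y z w}" (is "?L = ?R")
proof (intro equalityI subsetI)
  fix A assume "A \<in> ?L"
  then obtain g where g: "A = aut_matrix g" "g \<in> carrier (G_lam p m)"
    "act_lam p m g (ext_of_matrix p m (Mat2 x y z w)) = ext_of_matrix p m (Mat2 x y z w)"
    unfolding stabilizer_def by blast
  obtain a b c d where *: "a mod P = a" "b mod p = b" "c mod p = c" "d mod p = d"
    "\<not> p dvd a" "\<not> p dvd d" and g_eq: "g = endo a b c d"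
    using automorphism_is_endo[OF g(2)] by blast
  have "intertwines a b c d x y z w x y z w"
    using g(2,3) act_lam_eq_iff unfolding g_eq by blast
  moreover have "A = Mat2 a (p ^ m * b) c d" unfolding g(1) g_eq using * by (intro aut_matrix_endo)
  moreover have "a \<in> Units (poly_quot P)" "d \<in> Units (poly_quot p)"
    using * by (simp_all only: Units_P Units_p simp_thms)
  ultimately show "A \<in> ?R"
    unfolding mem_Collect_eq using *(2,3) by (intro exI conjI) 
next
  fix A assume "A \<in> ?R"
  then obtain a b c d where *: "A = Mat2 a (p ^ m * b) c d" "a mod P = a" "b mod p = b" "c mod p = c"
    "d mod p = d" "\<not> p dvd a" "\<not> p dvd d" "intertwines a b c d x y z w x y z w"
    unfolding Units_P Units_p mem_Collect_eq by (elim exE conjE)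
  have G: "endo a b c d \<in> carrier (G_lam p m)" using * by (intro endo_is_automorphism)
  then have "endo a b c d \<in> stabilizer (G_lam p m) (act_lam p m) (ext_of_matrix p m (Mat2 x y z w))"
    unfolding stabilizer_def mem_Collect_eq act_lam_eq_iff[OF G] using *(8) by (intro conjI)
  moreover have "A = aut_matrix (endo a b c d)" unfolding *(1) using * by (intro aut_matrix_endo[symmetric])
  ultimately show "A \<in> ?L" by blast
qed

section \<open>Orbits\<close>

definition linked where
  "linked x y z w x' y' z' w' \<longleftrightarrow>
    (\<exists>a b c d. \<not> p dvd a \<and> \<not> p dvd d \<and> intertwines a b c d x y z w x' y' z' w')"

lemma act_lam_linked:
  "(\<exists>g\<in>carrier (G_lam p m). act_lam p m g (ext_of_matrix p m (Mat2 x y z w)) = ext_of_matrix p m (Mat2 x' y' z' w'))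
    \<longleftrightarrow> linked x y z w x' y' z' w'"
  unfolding linked_def using act_lam_eq_iff automorphism_is_endo endo_is_automorphism by metis

lemma orbit_linked:
  assumes "Orb \<in> orbits (G_lam p m) (E_lam p m) (act_lam p m)"
  shows "\<exists>x y z w. \<forall>x' y' z' w'. ext_of_matrix p m (Mat2 x' y' z' w') \<in> Orb \<longleftrightarrow> linked x y z w x' y' z' w'"
proof -
  from assms obtain C where C: "C \<in> E_lam p m" "Orb = orbit (G_lam p m) (act_lam p m) C"
    unfolding orbits_def by blast
  then obtain x y z w where "C = ext_of_matrix p m (Mat2 x y z w)" unfolding E_lam_iff by blast
  then show ?thesis
    unfolding C(2) orbit_def mem_Collect_eq act_lam_linked[symmetric] by metis
qed

text \<open>Composing the inverse of one morphism with the other avoids any computation with inverse matrices.\<close>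

lemma linked_euclidean:
  assumes "linked x y z w x1 y1 z1 w1" "linked x y z w x2 y2 z2 w2"
  shows "linked x1 y1 z1 w1 x2 y2 z2 w2"
proof -
  obtain a b c d where 1: "\<not> p dvd a" "\<not> p dvd d" "intertwines a b c d x y z w x1 y1 z1 w1"
    using assms(1) by (auto simp: linked_def)
  obtain a' b' c' d' where 2: "\<not> p dvd a'" "\<not> p dvd d'" "intertwines a' b' c' d' x y z w x2 y2 z2 w2"
    using assms(2) by (auto simp: linked_def)
  let ?g = "endo a b c d" and ?g' = "endo a' b' c' d'"
  have g: "?g \<in> carrier (mod_AutoGroup kt M)" and g': "?g' \<in> carrier (mod_AutoGroup kt M)"
    using endo_is_automorphism 1 2 by (simp_all only: G_lam_def)
  define h where "h = inv\<^bsub>mod_AutoGroup kt M\<^esub> ?g"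
  have gh: "inverse_endos kt M ?g h" unfolding h_def by (rule inverse_endos_inv[OF module_M g])
  interpret G: group "mod_AutoGroup kt M" by (rule group_mod_AutoGroup[OF module_M])
  let ?k = "?g' \<otimes>\<^bsub>mod_AutoGroup kt M\<^esub> h"
  have h: "h \<in> carrier (mod_AutoGroup kt M)" unfolding h_def using g by (rule G.inv_closed)
  have k: "?k \<in> carrier (mod_AutoGroup kt M)" using g' h by (rule G.m_closed)
  have k_eq: "?k t = ?g' (h t)" if "t \<in> carrier M" for t
    using that mult_mod_AutoGroup[OF g' h] by (simp add: compose_eq del: M_simps)
  obtain a'' b'' c'' d'' where 3: "\<not> p dvd a''" "\<not> p dvd d''" "?k = endo a'' b'' c'' d''"
    using automorphism_is_endo k by (metis G_lam_def)
  obtain Y i q where \<xi>: "(Y, i, q) \<in> ext_of_matrix p m (Mat2 x y z w)"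
    using ext_of_matrix_nonempty by (metis ex_in_conv prod_cases3)
  obtain Y1 i1 q1 where \<xi>1: "(Y1, i1, q1) \<in> ext_of_matrix p m (Mat2 x1 y1 z1 w1)"
    using ext_of_matrix_nonempty by (metis ex_in_conv prod_cases3)
  obtain Y2 i2 q2 where \<xi>2: "(Y2, i2, q2) \<in> ext_of_matrix p m (Mat2 x2 y2 z2 w2)"
    using ext_of_matrix_nonempty by (metis ex_in_conv prod_cases3)
  have ext: "(Y, i, q) \<in> extensions kt M M" "(Y1, i1, q1) \<in> extensions kt M M"
    using \<xi> \<xi>1 ext_of_matrix_subset by blast+
  obtain f1 f2 f1' f2' f1'' f2'' where E: "extn_with_matrix p m Y i q f1 f2 x y z w"
    "extn_with_matrix p m Y1 i1 q1 f1' f2' x1 y1 z1 w1" "extn_with_matrix p m Y2 i2 q2 f1'' f2'' x2 y2 z2 w2"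
    using \<xi> \<xi>1 \<xi>2 unfolding ext_of_matrix_iff by blast
  obtain \<phi>1 where "extn_mor kt M ?g \<phi>1 ?g (Y, i, q) (Y1, i1, q1)"
    using morphism_if_intertwines[OF E(1,2) 1(3)] by blast
  then obtain \<psi>1 where \<psi>1: "extn_mor kt M h \<psi>1 h (Y1, i1, q1) (Y, i, q)"
    using extn_mor_inverse[OF module_M ext _ gh gh] by blast
  obtain \<phi>2 where \<phi>2: "extn_mor kt M ?g' \<phi>2 ?g' (Y, i, q) (Y2, i2, q2)"
    using morphism_if_intertwines[OF E(1,3) 2(3)] by blast
  have "extn_mor kt M ?k (\<phi>2 \<circ> \<psi>1) ?k (Y1, i1, q1) (Y2, i2, q2)"
    by (rule extn_mor_comp[OF ext(2) _ \<psi>1 \<phi>2])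
      (use gh in \<open>simp_all add: inverse_endos_def k_eq del: M_simps\<close>)
  then have "intertwines a'' b'' c'' d'' x1 y1 z1 w1 x2 y2 z2 w2"
    unfolding 3(3) by (rule intertwines_if_morphism[OF E(2,3)])
  then show ?thesis unfolding linked_def using 3 by blast
qed

section \<open>Representatives of the orbits\<close>

definition representatives :: "'k poly set \<Rightarrow> 'k poly mat2 set"
  where "representatives T =
    {Mat2 x 0 0 w | x w. x \<in> carrier (poly_quot P) \<and> p dvd x \<and> w \<in> carrier (poly_quot p)} \<union>
    {Mat2 x 0 0 w | x w. x \<in> Units (poly_quot P) \<and> w \<in> carrier (poly_quot p)} \<union>
    {Mat2 x 1 z w | x z w. x \<in> T \<and> z \<in> carrier (poly_quot p) \<and> w \<in> carrier (poly_quot p)} \<union>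
    {Mat2 x 0 1 w | x w. x \<in> T \<and> w \<in> carrier (poly_quot p)}"

lemma representatives_iff:
  "Mat2 x y z w \<in> representatives T \<longleftrightarrow> w mod p = w \<and>
    (y = 0 \<and> z = 0 \<and> x mod P = x \<or> y = 1 \<and> z mod p = z \<and> x \<in> T \<or> y = 0 \<and> z = 1 \<and> x \<in> T)"
  unfolding representatives_def by (auto simp: carrier_poly_quot Units_P)

lemma reduced_eq_iff: "a mod q = a \<Longrightarrow> b mod q = b \<Longrightarrow> a = b \<longleftrightarrow> q dvd a - b" for a b q :: "'k poly"
  by (metis mod_eq_dvd_iff)

context
  fixes T :: "'k poly set"
  assumes T: "bij_betw (\<lambda>x. x mod p ^ m) T {c \<in> carrier (poly_quot (p ^ m)). p dvd c}"
begin

lemma p_dvd_T: "x \<in> T \<Longrightarrow> p dvd x"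
proof -
  assume "x \<in> T"
  then have "p dvd x mod p ^ m" using T by (auto simp: bij_betw_def)
  then show "p dvd x" by (simp add: dvd_mod_iff[OF p_dvd_power])
qed

lemma T_eq: "x \<in> T \<Longrightarrow> x' \<in> T \<Longrightarrow> p ^ m dvd x - x' \<Longrightarrow> x = x'"
  using T by (auto simp: bij_betw_def inj_on_def mod_eq_dvd_iff)

lemma T_representative:
  assumes "p dvd x"
  obtains t e where "t \<in> T" "x - t = p ^ m * e"
proof -
  have "x mod p ^ m \<in> (\<lambda>x. x mod p ^ m) ` T"
    using T assms by (simp add: bij_betw_def carrier_poly_quot dvd_mod_iff[OF p_dvd_power])
  then obtain t where t: "t \<in> T" "x mod p ^ m = t mod p ^ m" by auto
  then have "p ^ m dvd x - t" by (simp add: mod_eq_dvd_iff)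
  then obtain e where "x - t = p ^ m * e" by (rule dvdE)
  with t(1) show ?thesis by (rule that)
qed

text \<open>If \<open>x\<close> is prime to \<open>p\<close>, elementary row and column operations with the pivot
  \<open>x\<close> clear \<open>y\<close> and \<open>z\<close>. If \<open>p\<close> divides \<open>x\<close>
  and one of \<open>y\<close>, \<open>z\<close> is prime to \<open>p\<close>, a diagonal matrix scales that
  entry to \<open>1\<close>, and an off-diagonal entry then replaces \<open>x\<close> by the representative
  of its class modulo \<open>p^m\<close>. If \<open>p\<close> divides all three, reducing the entries is
  enough.\<close>

lemma linked_to_representative:
  "\<exists>x' y' z' w'. Mat2 x' y' z' w' \<in> representatives T \<and> linked x y z w x' y' z' w'"
proof (cases "p dvd x")
  case False
  then obtain r where r: "p dvd x * r - 1" using irreducible_poly_inverse[OF irr] by blast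
  \<comment> \<open>r is the inverse of the pivot x modulo p\<close>
  define b c where "b = r * y" and "c = - (r * z)"
  define x' w' where "x' = (x + p ^ m * b * z) mod P" and "w' = (w + c * y) mod p"
  have x': "P dvd (x + p ^ m * b * z) - x'" and w': "p dvd (w + c * y) - w'"
    by (simp_all add: x'_def w'_def mod_eq_dvd_iff[symmetric])
  have "p dvd (x + p ^ m * b * z) - x' - p ^ m * (b * z)"
    using p_dvd_power by (intro dvd_diff[OF P_dvd_imp[OF x']]) simp
  then have xx': "p dvd x - x'" by (simp add: algebra_simps)
  have "p dvd (x - x') * b - (x * r - 1) * y" using xx' r by (intro dvd_diff) simp_all
  then have 2: "p dvd y - x' * b" by (simp add: b_def algebra_simps)
  have "p dvd - ((x * r - 1) * z)" using r by simp
  then have 3: "p dvd c * x + z" by (simp add: c_def algebra_simps)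
  have "intertwines 1 b c 1 x y z w x' 0 0 w'"
    using x' w' 2 3 by (simp add: intertwines_def add.commute)
  then have "linked x y z w x' 0 0 w'" unfolding linked_def using p_not_dvd_one by blast
  moreover have "Mat2 x' 0 0 w' \<in> representatives T"
    by (simp add: representatives_iff x'_def w'_def)
  ultimately show ?thesis by blast
next
  case x: True
  obtain t e where t: "t \<in> T" and e: "x - t = p ^ m * e" using T_representative[OF x] .
  have x_eq: "x = t + p ^ m * e" using e by (simp add: algebra_simps)
  consider "\<not> p dvd y" | "p dvd y" "\<not> p dvd z" | "p dvd y" "p dvd z" by blast
  then show ?thesis
  proof cases
    case 1
    \<comment> \<open>the diagonal matrix (1, y) scales y to 1; the lower left entry e turns x into t\<close>
    define z' w' where "z' = (y * z) mod p" and "w' = (e + w) mod p"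
    have z': "p dvd y * z - z'" and w': "p dvd (e + w) - w'"
      by (simp_all add: z'_def w'_def mod_eq_dvd_iff[symmetric])
    have "p dvd e * x + (y * z - z')" using x z' by (intro dvd_add) simp_all
    moreover have "p dvd y * ((e + w) - w')" using w' by (rule dvd_mult)
    ultimately have "intertwines 1 0 e y x y z w t 1 z' w'"
      using e by (simp add: intertwines_def algebra_simps)
    then have "linked x y z w t 1 z' w'" unfolding linked_def using p_not_dvd_one 1 by blast
    moreover have "Mat2 t 1 z' w' \<in> representatives T"
      by (simp add: representatives_iff z'_def w'_def t)
    ultimately show ?thesis by blast
  next
    case 2
    \<comment> \<open>the diagonal matrix (z, 1) scales z to 1; the upper right entry - e turns x into t\<close>
    define w' where "w' = (w + e) mod p"
    have w': "p dvd (w + e) - w'" by (simp add: w'_def mod_eq_dvd_iff[symmetric])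
    have "p dvd z * y + t * e" using p_dvd_T[OF t] 2 by (intro dvd_add) simp_all
    moreover have "P dvd (z * x + p ^ m * (- e) * z) - (t * z + p ^ m * 0 * 0)"
      unfolding x_eq by (simp add: algebra_simps)
    ultimately have "intertwines z (- e) 0 1 x y z w t 0 1 w'"
      using w' by (simp add: intertwines_def algebra_simps)
    then have "linked x y z w t 0 1 w'" unfolding linked_def using p_not_dvd_one 2 by blast
    moreover have "Mat2 t 0 1 w' \<in> representatives T"
      by (simp add: representatives_iff w'_def t)
    ultimately show ?thesis by blast
  next
    case 3
    have "intertwines 1 0 0 1 x y z w (x mod P) 0 0 (w mod p)"
      using 3 by (simp add: intertwines_def mod_eq_dvd_iff[symmetric])
    then have "linked x y z w (x mod P) 0 0 (w mod p)"
      unfolding linked_def using p_not_dvd_one by blast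
    moreover have "Mat2 (x mod P) 0 0 (w mod p) \<in> representatives T"
      by (simp add: representatives_iff)
    ultimately show ?thesis by blast
  qed
qed

text \<open>The class of \<open>x\<close> modulo \<open>p\<close> is invariant, so the cases
  \<open>p dvd x\<close> and its negation do not mix. In the diagonal case the congruences for
  \<open>x\<close> and \<open>w\<close> decouple. Otherwise \<open>p\<close> divides \<open>x\<close>, the
  vanishing of \<open>y\<close> and of \<open>z\<close> is preserved, and \<open>x\<close> is determined
  modulo \<open>p^m\<close>, hence equal on both sides; the first congruence then couples \<open>b\<close>
  and \<open>c\<close> in the way that makes \<open>w\<close> invariant.\<close>

lemma linked_representatives_eq:
  assumes A: "Mat2 x y z w \<in> representatives T" and A': "Mat2 x' y' z' w' \<in> representatives T"
    and linked: "linked x y z w x' y' z' w'"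
  shows "Mat2 x y z w = Mat2 x' y' z' w'"
proof -
  obtain a b c d where a: "\<not> p dvd a" and d: "\<not> p dvd d"
    and 1: "P dvd (a * x + p ^ m * b * z) - (x' * a + p ^ m * c * y')"
    and 2: "p dvd a * y - (x' * b + y' * d)"
    and 3: "p dvd (c * x + d * z) - z' * a"
    and 4: "p dvd (c * y + d * w) - (z' * b + w' * d)"
    using linked by (auto simp: linked_def intertwines_def)
  have "p dvd (a * x + p ^ m * b * z) - (x' * a + p ^ m * c * y') - p ^ m * (b * z - c * y')"
    using p_dvd_power by (intro dvd_diff[OF P_dvd_imp[OF 1]]) simp
  also have "\<dots> = a * (x - x')" by (simp add: algebra_simps)
  finally have xx': "p dvd x - x'" using a by (simp add: p_dvd_mult_iff)
  have w_eq: "w = w'" if "p dvd d * (w - w')"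
    using that d A A' by (simp add: representatives_iff p_dvd_mult_iff reduced_eq_iff[of w p w'])
  show ?thesis
  proof (cases "y = 0 \<and> z = 0 \<and> y' = 0 \<and> z' = 0")
    case True
    then have "P dvd a * (x - x')" using 1 by (simp add: algebra_simps)
    then have "P dvd x - x'" using a by (rule P_dvd_cancel_unit)
    then have "x = x'"
      using A A' True by (simp add: representatives_iff reduced_eq_iff[of x P x'])
    moreover have "w = w'" using w_eq 4 True by (simp add: algebra_simps)
    ultimately show ?thesis using True by simp
  next
    case False
    then have "x \<in> T \<or> x' \<in> T" using A A' by (auto simp: representatives_iff)
    then have x: "p dvd x" and x': "p dvd x'"
      using p_dvd_T xx' by (metis dvd_diff_left_iff dvd_diff_right_iff)+
    have "p dvd a * y - (x' * b + y' * d) + x' * b" using 2 x' by (intro dvd_add) simp_all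
    then have y: "p dvd a * y - y' * d" by (simp add: algebra_simps)
    have "p dvd (c * x + d * z) - z' * a - c * x" using x by (intro dvd_diff[OF 3]) simp
    then have z: "p dvd d * z - z' * a" by (simp add: algebra_simps)
    have yy': "y = y'"
      using A A' y a d by (auto simp: representatives_iff)
    have T_mem: "x \<in> T" "x' \<in> T"
    proof -
      have "z = 0 \<longleftrightarrow> z' = 0" if "y = 0"
        using A A' z a d that yy' by (auto simp: representatives_iff)
      then show "x \<in> T" "x' \<in> T" using False A A' yy' by (auto simp: representatives_iff)
    qed
    have "p ^ m dvd (a * x + p ^ m * b * z) - (x' * a + p ^ m * c * y') - p ^ m * (b * z - c * y')"
      by (intro dvd_diff[OF dvd_trans[OF _ 1]]) (simp_all add: P_def)
    also have "\<dots> = a * (x - x')" by (simp add: algebra_simps)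
    finally have am: "p ^ m dvd a * (x - x')" .
    obtain a' where a': "p ^ m dvd a * a' - 1" using irreducible_power_inverse[OF irr a] by blast
    have "p ^ m dvd a' * (a * (x - x')) - (x - x') * (a * a' - 1)"
      using am a' by (intro dvd_diff) simp_all
    then have "p ^ m dvd x - x'" by (simp add: algebra_simps)
    then have xx': "x = x'" using T_mem T_eq by blast
    have "P dvd p ^ m * (b * z - c * y')" using 1 by (simp add: xx' algebra_simps)
    then have bc: "p dvd b * z - c * y'" by (simp only: P_dvd_power_mult_iff)
    show ?thesis
    proof (cases "y = 0")
      case False
      then have y1: "y = 1" "y' = 1" using A yy' by (auto simp: representatives_iff)
      have "p dvd (d * z - z' * a) + z * (a * y - y' * d)" using y z by (intro dvd_add) simp_all
      also have "\<dots> = a * (z - z')" by (simp add: y1 algebra_simps)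
      finally have "p dvd z - z'" using a by (simp add: p_dvd_mult_iff)
      then have zz': "z = z'"
        using A A' y1 by (simp add: representatives_iff reduced_eq_iff[of z p z'])
      have "p dvd ((c * y + d * w) - (z' * b + w' * d)) + (b * z - c * y')"
        using 4 bc by (rule dvd_add)
      also have "\<dots> = d * (w - w')" by (simp add: y1 zz' algebra_simps)
      finally show ?thesis using w_eq xx' yy' zz' by simp
    next
      case True
      then have z1: "z = 1" "z' = 1"
        using A A' z a d yy' \<open>\<not> (y = 0 \<and> z = 0 \<and> y' = 0 \<and> z' = 0)\<close> by (auto simp: representatives_iff)
      have "p dvd ((c * y + d * w) - (z' * b + w' * d)) + (b * z - c * y')"
        using 4 bc by (rule dvd_add)
      also have "\<dots> = d * (w - w')" using True yy' by (simp add: z1 algebra_simps)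
      finally show ?thesis using w_eq xx' yy' z1 by simp
    qed
  qed
qed

lemma unique_representative:
  assumes "Orb \<in> orbits (G_lam p m) (E_lam p m) (act_lam p m)"
  shows "\<exists>!A. A \<in> representatives T \<and> ext_of_matrix p m A \<in> Orb"
proof -
  obtain x y z w where Orb: "\<And>x' y' z' w'. ext_of_matrix p m (Mat2 x' y' z' w') \<in> Orb \<longleftrightarrow> linked x y z w x' y' z' w'"
    using orbit_linked[OF assms] by blast
  show ?thesis
  proof (rule ex_ex1I)
    show "\<exists>A. A \<in> representatives T \<and> ext_of_matrix p m A \<in> Orb"
      using linked_to_representative Orb by metis
  next
    fix A A' assume *: "A \<in> representatives T \<and> ext_of_matrix p m A \<in> Orb"
      "A' \<in> representatives T \<and> ext_of_matrix p m A' \<in> Orb"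
    obtain x1 y1 z1 w1 x2 y2 z2 w2 where A: "A = Mat2 x1 y1 z1 w1" "A' = Mat2 x2 y2 z2 w2"
      by (metis mat2.exhaust)
    then have "linked x1 y1 z1 w1 x2 y2 z2 w2" using * Orb linked_euclidean by blast
    then show "A = A'" using linked_representatives_eq * unfolding A by blast
  qed
qed

text \<open>With \<open>x\<close>, \<open>z\<close>, \<open>w\<close> kept fixed, the first congruence becomes
  \<open>c = b z\<close> and the second \<open>d = a\<close> modulo \<open>p\<close>; these imply the other two.\<close>

lemma stabilizer_row:
  assumes "x \<in> T" "z mod p = z"
  shows "aut_matrix ` stabilizer (G_lam p m) (act_lam p m) (ext_of_matrix p m (Mat2 x 1 z w)) =
    {Mat2 a (p ^ m * b) ((b * z) mod p) (a mod p) | a b.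
      a \<in> Units (poly_quot P) \<and> b \<in> carrier (poly_quot p)}"
proof -
  have x: "p dvd x" using p_dvd_T assms by blast
  have "intertwines a b c d x 1 z w x 1 z w \<longleftrightarrow> p dvd b * z - c \<and> p dvd a - d" for a b c d
  proof -
    have "P dvd (a * x + p ^ m * b * z) - (x * a + p ^ m * c * 1) \<longleftrightarrow> p dvd b * z - c"
      unfolding P_dvd_power_mult_iff[symmetric] by (simp add: algebra_simps)
    moreover have "p dvd a * 1 - (x * b + 1 * d) \<longleftrightarrow> p dvd a - d"
      using dvd_diff_left_iff[of p "x * b" "a - d"] x by (simp add: algebra_simps)
    moreover have "p dvd (c * x + d * z) - z * a" if "p dvd a - d"
    proof -
      have "p dvd c * x - z * (a - d)" using that x by (intro dvd_diff) simp_all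
      then show ?thesis by (simp add: algebra_simps)
    qed
    moreover have "p dvd (c * 1 + d * w) - (z * b + w * d)" if "p dvd b * z - c"
    proof -
      have "p dvd - (b * z - c)" using that by (simp only: dvd_minus_iff)
      then show ?thesis by (simp add: algebra_simps)
    qed
    ultimately show ?thesis unfolding intertwines_def by blast
  qed
  moreover have "p dvd b * z - c \<longleftrightarrow> c = (b * z) mod p" if "c mod p = c" for b c
    using that by (metis mod_eq_dvd_iff)
  moreover have "p dvd a - d \<longleftrightarrow> d = a mod p" if "d mod p = d" for a d
    using that by (metis mod_eq_dvd_iff)
  moreover have "a mod p \<in> Units (poly_quot p)" if "a \<in> Units (poly_quot P)" for a
    using that by (simp add: Units_P Units_p dvd_mod_iff)
  ultimately show ?thesis
    unfolding stabilizer_matrices carrier_poly_quot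
    by (intro Collect_cong) (auto simp: Units_p)
qed

lemma stabilizer_column:
  assumes "x \<in> T"
  shows "aut_matrix ` stabilizer (G_lam p m) (act_lam p m) (ext_of_matrix p m (Mat2 x 0 1 w)) =
    {Mat2 a 0 c (a mod p) | a c. a \<in> Units (poly_quot P) \<and> c \<in> carrier (poly_quot p)}"
proof -
  have x: "p dvd x" using p_dvd_T assms by blast
  have "intertwines a b c d x 0 1 w x 0 1 w \<longleftrightarrow> p dvd b \<and> p dvd a - d" for a b c d
  proof -
    have "P dvd (a * x + p ^ m * b * 1) - (x * a + p ^ m * c * 0) \<longleftrightarrow> p dvd b"
      unfolding P_dvd_power_mult_iff[symmetric] by (simp add: algebra_simps)
    moreover have "p dvd a * 0 - (x * b + 0 * d)" using x by simp
    moreover have "p dvd (c * x + d * 1) - 1 * a \<longleftrightarrow> p dvd a - d"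
      using dvd_diff_right_iff[of p "c * x" "a - d"] x by (simp add: algebra_simps)
    moreover have "p dvd (c * 0 + d * w) - (1 * b + w * d) \<longleftrightarrow> p dvd b"
      by (simp add: algebra_simps)
    ultimately show ?thesis unfolding intertwines_def by blast
  qed
  moreover have "p dvd b \<longleftrightarrow> b = 0" if "b mod p = b" for b
    using that by (metis dvd_eq_mod_eq_0)
  moreover have "p dvd a - d \<longleftrightarrow> d = a mod p" if "d mod p = d" for a d
    using that by (metis mod_eq_dvd_iff)
  moreover have "a mod p \<in> Units (poly_quot p)" if "a \<in> Units (poly_quot P)" for a
    using that by (simp add: Units_P Units_p dvd_mod_iff)
  ultimately show ?thesis
    unfolding stabilizer_matrices carrier_poly_quot
    by (intro Collect_cong) (auto simp: Units_p p_nonzero)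
qed

end

lemma stabilizer_nilpotent:
  assumes "p dvd x"
  shows "stabilizer (G_lam p m) (act_lam p m) (ext_of_matrix p m (Mat2 x 0 0 w)) = carrier (G_lam p m)"
proof (intro equalityI subsetI)
  fix g assume g: "g \<in> carrier (G_lam p m)"
  then obtain a b c d where g_eq: "g = endo a b c d" using automorphism_is_endo by blast
  have "intertwines a b c d x 0 0 w x 0 0 w"
    using assms by (simp add: intertwines_def mult.commute)
  then show "g \<in> stabilizer (G_lam p m) (act_lam p m) (ext_of_matrix p m (Mat2 x 0 0 w))"
    using g act_lam_eq_iff unfolding g_eq stabilizer_def by blast
qed (simp add: stabilizer_def)

lemma stabilizer_unit:
  assumes "\<not> p dvd x"
  shows "aut_matrix ` stabilizer (G_lam p m) (act_lam p m) (ext_of_matrix p m (Mat2 x 0 0 w)) =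
    {Mat2 a 0 0 d | a d. a \<in> Units (poly_quot P) \<and> d \<in> Units (poly_quot p)}"
proof -
  have "intertwines a b c d x 0 0 w x 0 0 w \<longleftrightarrow> p dvd b \<and> p dvd c" for a b c d
    using assms by (auto simp: intertwines_def mult.commute p_dvd_mult_iff)
  moreover have "p dvd b \<longleftrightarrow> b = 0" if "b mod p = b" for b
    using that by (metis dvd_eq_mod_eq_0)
  ultimately show ?thesis
    unfolding stabilizer_matrices by (intro Collect_cong) (auto simp: p_nonzero)
qed

end

theorem theorem8p5:
  fixes p :: "'k::field poly" and m :: nat and T :: "'k poly set"
  assumes "lead_coeff p = 1" and "Factorial_Ring.irreducible p" and "m \<ge> 1"
    and "T \<subseteq> carrier (poly_quot (p ^ (m + 1)))"
    and "bij_betw (\<lambda>x. x mod p ^ m) T {c \<in> carrier (poly_quot (p ^ m)). p dvd c}"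
  shows "(let reps =
        {Mat2 x 0 0 w | x w. x \<in> carrier (poly_quot (p ^ (m + 1))) \<and> p dvd x \<and> w \<in> carrier (poly_quot p)} \<union>
        {Mat2 x 0 0 w | x w. x \<in> Units (poly_quot (p ^ (m + 1))) \<and> w \<in> carrier (poly_quot p)} \<union>
        {Mat2 x 1 z w | x z w. x \<in> T \<and> z \<in> carrier (poly_quot p) \<and> w \<in> carrier (poly_quot p)} \<union>
        {Mat2 x 0 1 w | x w. x \<in> T \<and> w \<in> carrier (poly_quot p)}
      in (\<forall>A\<in>reps. ext_of_matrix p m A \<in> E_lam p m) \<and>
         (\<forall>Orb\<in>orbits (G_lam p m) (E_lam p m) (act_lam p m). \<exists>!A. A \<in> reps \<and> ext_of_matrix p m A \<in> Orb)) \<and>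
    (\<forall>x\<in>carrier (poly_quot (p ^ (m + 1))). \<forall>w\<in>carrier (poly_quot p). p dvd x \<longrightarrow>
      stabilizer (G_lam p m) (act_lam p m) (ext_of_matrix p m (Mat2 x 0 0 w)) = carrier (G_lam p m)) \<and>
    (\<forall>x\<in>Units (poly_quot (p ^ (m + 1))). \<forall>w\<in>carrier (poly_quot p).
      aut_matrix ` stabilizer (G_lam p m) (act_lam p m) (ext_of_matrix p m (Mat2 x 0 0 w)) =
        {Mat2 a 0 0 d | a d. a \<in> Units (poly_quot (p ^ (m + 1))) \<and> d \<in> Units (poly_quot p)}) \<and>
    (\<forall>x\<in>T. \<forall>z\<in>carrier (poly_quot p). \<forall>w\<in>carrier (poly_quot p).
      aut_matrix ` stabilizer (G_lam p m) (act_lam p m) (ext_of_matrix p m (Mat2 x 1 z w)) =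
        {Mat2 a (p ^ m * b) ((b * z) mod p) (a mod p) | a b.
          a \<in> Units (poly_quot (p ^ (m + 1))) \<and> b \<in> carrier (poly_quot p)}) \<and>
    (\<forall>x\<in>T. \<forall>w\<in>carrier (poly_quot p).
      aut_matrix ` stabilizer (G_lam p m) (act_lam p m) (ext_of_matrix p m (Mat2 x 0 1 w)) =
        {Mat2 a 0 c (a mod p) | a c.
          a \<in> Units (poly_quot (p ^ (m + 1))) \<and> c \<in> carrier (poly_quot p)})"
proof -
  interpret hook_module p m by unfold_locales (fact assms)+
  show ?thesis
    unfolding P_def[symmetric] representatives_def[symmetric] Let_def
  proof (intro conjI ballI impI)
    fix A show "ext_of_matrix p m A \<in> E_lam p m"
      unfolding E_lam_iff by (cases A) blast
  next
    fix Orb assume "Orb \<in> orbits (G_lam p m) (E_lam p m) (act_lam p m)"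
    then show "\<exists>!A. A \<in> representatives T \<and> ext_of_matrix p m A \<in> Orb"
      by (rule unique_representative[OF assms(5)])
  next
    fix x w :: "'k poly" assume "p dvd x"
    then show "stabilizer (G_lam p m) (act_lam p m) (ext_of_matrix p m (Mat2 x 0 0 w)) =
        carrier (G_lam p m)" by (rule stabilizer_nilpotent)
  next
    fix x w assume "x \<in> Units (poly_quot P)"
    then show "aut_matrix ` stabilizer (G_lam p m) (act_lam p m) (ext_of_matrix p m (Mat2 x 0 0 w)) =
        {Mat2 a 0 0 d | a d. a \<in> Units (poly_quot P) \<and> d \<in> Units (poly_quot p)}"
      by (intro stabilizer_unit) (simp add: Units_P)
  next
    fix x z w assume "x \<in> T" "z \<in> carrier (poly_quot p)"
    then show "aut_matrix ` stabilizer (G_lam p m) (act_lam p m) (ext_of_matrix p m (Mat2 x 1 z w)) =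
        {Mat2 a (p ^ m * b) ((b * z) mod p) (a mod p) | a b.
          a \<in> Units (poly_quot P) \<and> b \<in> carrier (poly_quot p)}"
      by (intro stabilizer_row[OF assms(5)]) (simp_all add: carrier_poly_quot)
  next
    fix x w assume "x \<in> T"
    then show "aut_matrix ` stabilizer (G_lam p m) (act_lam p m) (ext_of_matrix p m (Mat2 x 0 1 w)) =
        {Mat2 a 0 c (a mod p) | a c. a \<in> Units (poly_quot P) \<and> c \<in> carrier (poly_quot p)}"
      by (rule stabilizer_column[OF assms(5)])
  qed
qed

end
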